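(* There exist infinitely many (pairwise non-isomorphic) tetravalent graphs of girth $5$ admitting a half-arc-transitive group of automorphisms such that each edge of the graph lies on a unique $5$-cycle, and there also exist infinitely many tetravalent graphs of girth $5$ admitting a half-arc-transitive group of automorphisms such that each edge of the graph lies on precisely two $5$-cycles.
   Context: Graphs are finite, simple, connected. A subgroup $G\le\mathrm{Aut}(\Gamma)$ is half-arc-transitive on $\Gamma$ if it is transitive on vertices and on edges but not on arcs (ordered pairs of adjacent vertices). *)

theory Defs
  imports
    "Graph_Theory.Graph_Theory"
    "HOL-Algebra.Bij"
    "HOL-Library.Extended_Nat"
begin

text \<open>
  A finite simple graph is a \<^locale>\<open>pair_graph\<close>, i.e. a finite, loop-free, symmetric set of
  ordered pairs. Its arcs in the sense of algebraic graph theory (ordered pairs of adjacent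
  vertices) are thus exactly \<^const>\<open>parcs\<close>, and the valency of a vertex is its
  \<^const>\<open>out_degree\<close>.
\<close>

definition edge_of :: "'a \<times> 'a \<Rightarrow> 'a set" where
  "edge_of a = {fst a, snd a}"

definition edges :: "'a pair_pre_digraph \<Rightarrow> 'a set set" where
  "edges \<Gamma> = edge_of ` parcs \<Gamma>"

definition regular_of_valency :: "nat \<Rightarrow> 'a pair_pre_digraph \<Rightarrow> bool" where
  "regular_of_valency k \<Gamma> \<longleftrightarrow> (\<forall>v\<in>pverts \<Gamma>. out_degree (with_proj \<Gamma>) v = k)"

text \<open>
  In a symmetric digraph \<^const>\<open>pre_digraph.cycle\<close> also holds of the walks \<open>u, v, u\<close> of length 2,
  which are not cycles of the undirected graph; hence the bound on the length.
\<close>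

definition cycle_walk :: "'a pair_pre_digraph \<Rightarrow> ('a \<times> 'a) list \<Rightarrow> bool" where
  "cycle_walk \<Gamma> p \<longleftrightarrow> pre_digraph.cycle (with_proj \<Gamma>) p \<and> 3 \<le> length p"

definition girth :: "'a pair_pre_digraph \<Rightarrow> enat" where
  "girth \<Gamma> = (INF p \<in> {p. cycle_walk \<Gamma> p}. enat (length p))"

text \<open>
  A cycle as a subgraph is determined by its edge set, so cycles are counted as edge sets:
  the choice of a starting vertex and of a direction of traversal is forgotten.
\<close>

definition cycles_of_length :: "nat \<Rightarrow> 'a pair_pre_digraph \<Rightarrow> 'a set set set" where
  "cycles_of_length k \<Gamma> = {edge_of ` set p | p. cycle_walk \<Gamma> p \<and> length p = k}"

definition each_edge_on_cycles :: "nat \<Rightarrow> nat \<Rightarrow> 'a pair_pre_digraph \<Rightarrow> bool" where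
  "each_edge_on_cycles m k \<Gamma> \<longleftrightarrow> (\<forall>e\<in>edges \<Gamma>. card {C \<in> cycles_of_length k \<Gamma>. e \<in> C} = m)"

definition graph_automorphisms :: "'a pair_pre_digraph \<Rightarrow> ('a \<Rightarrow> 'a) set" where
  "graph_automorphisms \<Gamma> = {f \<in> Bij (pverts \<Gamma>).
     \<forall>u\<in>pverts \<Gamma>. \<forall>v\<in>pverts \<Gamma>. (f u, f v) \<in> parcs \<Gamma> \<longleftrightarrow> (u, v) \<in> parcs \<Gamma>}"

definition Aut_graph :: "'a pair_pre_digraph \<Rightarrow> ('a \<Rightarrow> 'a) monoid" where
  "Aut_graph \<Gamma> = BijGroup (pverts \<Gamma>) \<lparr>carrier := graph_automorphisms \<Gamma>\<rparr>"

definition transitive_via :: "('g \<Rightarrow> 'x \<Rightarrow> 'x) \<Rightarrow> 'g set \<Rightarrow> 'x set \<Rightarrow> bool" where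
  "transitive_via act G X \<longleftrightarrow> (\<forall>x\<in>X. \<forall>y\<in>X. \<exists>g\<in>G. act g x = y)"

definition half_arc_transitive :: "('a \<Rightarrow> 'a) set \<Rightarrow> 'a pair_pre_digraph \<Rightarrow> bool" where
  "half_arc_transitive G \<Gamma> \<longleftrightarrow>
     subgroup G (Aut_graph \<Gamma>) \<and>
     transitive_via (\<lambda>g v. g v) G (pverts \<Gamma>) \<and>
     transitive_via (\<lambda>g e. g ` e) G (edges \<Gamma>) \<and>
     \<not> transitive_via (\<lambda>g a. (g (fst a), g (snd a))) G (parcs \<Gamma>)"

definition finite_simple_connected :: "'a pair_pre_digraph \<Rightarrow> bool" where
  "finite_simple_connected \<Gamma> \<longleftrightarrow>
     pair_graph \<Gamma> \<and> Digraph_Component.connected (with_proj \<Gamma>)"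

text \<open>
  Every finite graph is isomorphic to one with vertices in \<^typ>\<open>nat\<close>, so nothing is lost by
  taking the vertices there. Infinitude up to isomorphism is an infinite set of pairwise
  non-isomorphic graphs.
\<close>

definition infinitely_many_graphs :: "(nat pair_pre_digraph \<Rightarrow> bool) \<Rightarrow> bool" where
  "infinitely_many_graphs P \<longleftrightarrow>
     (\<exists>S :: nat pair_pre_digraph set. infinite S \<and> (\<forall>\<Gamma>\<in>S. P \<Gamma>) \<and>
        pairwise (\<lambda>\<Gamma> \<Delta>. \<not> digraph_iso (with_proj \<Gamma>) (with_proj \<Delta>)) S)"

lemma group_Aut_graph: "group (Aut_graph \<Gamma>)"
proof -
  interpret B: group "BijGroup (pverts \<Gamma>)" by (rule group_BijGroup)
  have "subgroup (graph_automorphisms \<Gamma>) (BijGroup (pverts \<Gamma>))"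
  proof (rule B.subgroupI)
    show "graph_automorphisms \<Gamma> \<subseteq> carrier (BijGroup (pverts \<Gamma>))"
      by (auto simp: graph_automorphisms_def BijGroup_def)
    have "(\<lambda>x\<in>pverts \<Gamma>. x) \<in> graph_automorphisms \<Gamma>"
      by (auto simp: graph_automorphisms_def id_Bij)
    then show "graph_automorphisms \<Gamma> \<noteq> {}" by blast
  next
    fix f assume f: "f \<in> graph_automorphisms \<Gamma>"
    then have fB: "f \<in> Bij (pverts \<Gamma>)" by (simp add: graph_automorphisms_def)
    then have im: "f ` pverts \<Gamma> = pverts \<Gamma>" by (auto simp: Bij_def bij_betw_def)
    let ?i = "inv_into (pverts \<Gamma>) f"
    have i: "?i u \<in> pverts \<Gamma>" "f (?i u) = u" if "u \<in> pverts \<Gamma>" for u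
      using that im by (auto simp: inv_into_into f_inv_into_f)
    have "((?i u), (?i v)) \<in> parcs \<Gamma> \<longleftrightarrow> (u, v) \<in> parcs \<Gamma>"
      if "u \<in> pverts \<Gamma>" "v \<in> pverts \<Gamma>" for u v
      using f i[OF that(1)] i[OF that(2)] unfolding graph_automorphisms_def by force
    then show "inv\<^bsub>BijGroup (pverts \<Gamma>)\<^esub> f \<in> graph_automorphisms \<Gamma>"
      using fB by (simp add: inv_BijGroup graph_automorphisms_def restrict_inv_into_Bij)
  next
    fix f g assume "f \<in> graph_automorphisms \<Gamma>" "g \<in> graph_automorphisms \<Gamma>"
    then show "f \<otimes>\<^bsub>BijGroup (pverts \<Gamma>)\<^esub> g \<in> graph_automorphisms \<Gamma>"
      by (auto simp: graph_automorphisms_def BijGroup_def compose_Bij compose_eq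
          dest: Bij_imp_funcset)
  qed
  then show ?thesis
    unfolding Aut_graph_def by (rule B.subgroup_imp_group)
qed

end

theory Submission
  imports Defs "HOL-Algebra.Generated_Groups"
begin

text \<open>
  Let \<open>G = \<langle>a, h\<rangle>\<close> be a finite group with \<open>h\<^sup>2 = 1\<close> and a homomorphism to \<open>\<int>/5\<close> sending \<open>a\<close> to \<open>1\<close> and
  \<open>h\<close> to \<open>0\<close>. Put \<open>H = {1, h}\<close> and orient the coset graph by \<open>gH \<rightarrow> gaH\<close>. Its arcs correspond to the
  elements of \<open>G\<close>, so left multiplication makes \<open>G\<close> transitive on vertices and edges while preserving
  the orientation. By the homomorphism there are no triangles and every 5-cycle is directed; the
  directed 5-cycles through a given arc correspond to the words \<open>s\<^sub>0 s\<^sub>1 s\<^sub>2 s\<^sub>3 s\<^sub>4 = 1\<close> with all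
  \<open>s\<^sub>i \<in> {a, ah}\<close>. A 4-cycle would force \<open>h\<close> to commute with \<open>a h a\<^sup>-\<^sup>1\<close> or a relation \<open>h s a = t a h\<close>
  with \<open>s, t \<in> {a, ah}\<close>.

  For the groups, let \<open>p\<close> and \<open>q\<close> be two reflections generating the dihedral group on \<open>m\<close> points.
  Inside its wreath product with \<open>\<int>/5\<close>, let \<open>a\<close> be the cyclic shift of the coordinates and
  \<open>h = (q, p, p, p, p)\<close> or \<open>h = (1, p, q, q, p)\<close>. In the first case a word with some factor \<open>ah\<close> has in
  some coordinate either an odd number of reflections or exactly one \<open>q\<close>, hence is not \<open>1\<close>, so only
  \<open>a\<^sup>5 = 1\<close> gives 5-cycles. In the second case \<open>p q q p = 1\<close>, so \<open>(ah)\<^sup>5 = 1\<close> gives a second orbit of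
  5-cycles, and every other word has an odd number of reflections in some coordinate. Letting \<open>m\<close>
  grow gives arbitrarily large graphs.
\<close>

section \<open>Short cycles\<close>

text \<open>A closed walk starts at the tail of its first arc and its later vertices are the heads
  of its arcs. So the start vertex need not be quantified, and distinctness concerns the heads
  alone.\<close>

lemma cycle_walk_conv:
  assumes "pair_wf_digraph \<Gamma>"
  shows "cycle_walk \<Gamma> p \<longleftrightarrow>
    3 \<le> length p \<and> set p \<subseteq> parcs \<Gamma> \<and> pcas (fst (hd p)) p (fst (hd p)) \<and> distinct (map snd p)"
proof -
  interpret pair_wf_digraph \<Gamma> by fact
  have verts: "pawalk_verts u q = u # map snd q" if "pcas u q w" for u q w
    using that by (induction q arbitrary: u) auto
  have *: "awalk u p u \<and> distinct (tl (pawalk_verts u p)) \<longleftrightarrow>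
      u = fst (hd p) \<and> set p \<subseteq> parcs \<Gamma> \<and> pcas u p u \<and> distinct (map snd p)" if "p \<noteq> []" for u
  proof (cases "pcas u p u")
    case True
    then show ?thesis using that verts[OF True] arc_fst_in_verts
      by (cases p) (force simp: awalk_def)+
  qed (simp add: awalk_def)
  show ?thesis
    unfolding cycle_walk_def cycle_def using * by (cases "p = []") auto
qed

lemma cycle_walk_3E:
  assumes "pair_wf_digraph \<Gamma>" "cycle_walk \<Gamma> p" "length p = 3"
  obtains w0 w1 w2 where "(w0, w1) \<in> parcs \<Gamma>" "(w1, w2) \<in> parcs \<Gamma>" "(w2, w0) \<in> parcs \<Gamma>"
proof -
  obtain e0 e1 e2 where "p = [e0, e1, e2]"
    using assms(3) by (auto simp: numeral_eq_Suc length_Suc_conv)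
  then show thesis
    using that assms(2) by (cases e0; cases e1; cases e2) (auto simp: cycle_walk_conv[OF assms(1)])
qed

lemma cycle_walk_4E:
  assumes "pair_wf_digraph \<Gamma>" "cycle_walk \<Gamma> p" "length p = 4"
  obtains w0 w1 w2 w3 where "(w0, w1) \<in> parcs \<Gamma>" "(w1, w2) \<in> parcs \<Gamma>" "(w2, w3) \<in> parcs \<Gamma>"
    "(w3, w0) \<in> parcs \<Gamma>" "w0 \<noteq> w2" "w1 \<noteq> w3"
proof -
  obtain e0 e1 e2 e3 where "p = [e0, e1, e2, e3]"
    using assms(3) by (auto simp: numeral_eq_Suc length_Suc_conv)
  then show thesis
    using that assms(2)
    by (cases e0; cases e1; cases e2; cases e3) (auto simp: cycle_walk_conv[OF assms(1)])
qed

lemma cycle_walk_5_iff: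
  assumes "pair_wf_digraph \<Gamma>"
  shows "cycle_walk \<Gamma> p \<and> length p = 5 \<longleftrightarrow>
    (\<exists>w0 w1 w2 w3 w4. p = [(w0, w1), (w1, w2), (w2, w3), (w3, w4), (w4, w0)] \<and>
       set p \<subseteq> parcs \<Gamma> \<and> distinct [w0, w1, w2, w3, w4])" (is "?L \<longleftrightarrow> ?R")
proof
  assume L: ?L
  then obtain e0 e1 e2 e3 e4 where "p = [e0, e1, e2, e3, e4]"
    by (auto simp: numeral_eq_Suc length_Suc_conv)
  then show ?R
    using L by (cases e0; cases e1; cases e2; cases e3; cases e4)
      (auto simp: cycle_walk_conv[OF assms(1)])
next
  assume ?R
  then show ?L by (auto simp: cycle_walk_conv[OF assms(1)])
qed

lemma edge_of_Pair [simp]: "edge_of (p, q) = {p, q}"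
  by (simp add: edge_of_def)

lemma residues_distinct:
  fixes n :: nat assumes "n < 5"
  shows "distinct [n, (n + 1) mod 5, (n + 2) mod 5, (n + 3) mod 5, (n + 4) mod 5]"
proof -
  have "n \<in> {0, 1, 2, 3, 4}" using assms by auto
  then show ?thesis by auto
qed

section \<open>Coset graphs of involutions\<close>

text \<open>\<open>lev\<close> plays the part of the homomorphism to the integers modulo 5, known
  only through right multiplication by the generators. \<open>B\<close> consists of the steps whose
  fifth power is \<open>\<one>\<close>; each contributes one 5-cycle through every edge.\<close>

locale coset_graph = group G for G (structure) +
  fixes a h :: 'a and v :: "'a \<Rightarrow> 'b" and lev :: "'a \<Rightarrow> nat" and B :: "'a set"
  assumes finite_carrier: "finite (carrier G)"
    and a_closed [simp, intro]: "a \<in> carrier G"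
    and h_closed [simp, intro]: "h \<in> carrier G"
    and h_h: "h \<otimes> h = \<one>"
    and generated: "generate G {a, h} = carrier G"
    and lev_a: "x \<in> carrier G \<Longrightarrow> lev (x \<otimes> a) = Suc (lev x) mod 5"
    and lev_h: "x \<in> carrier G \<Longrightarrow> lev (x \<otimes> h) = lev x"
    and v_eq_iff: \<comment> \<open>\<open>v x\<close> labels the coset \<open>{x, x \<otimes> h}\<close>, which lets the vertices live in any type\<close>
      "\<lbrakk>x \<in> carrier G; y \<in> carrier G\<rbrakk> \<Longrightarrow> v x = v y \<longleftrightarrow> y = x \<or> y = x \<otimes> h"
    and no_alternating_4_cycle: "h \<otimes> (a \<otimes> h \<otimes> inv a) \<noteq> (a \<otimes> h \<otimes> inv a) \<otimes> h"
    and no_parallel_4_cycle: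
      "\<lbrakk>s \<in> {a, a \<otimes> h}; t \<in> {a, a \<otimes> h}\<rbrakk> \<Longrightarrow> h \<otimes> s \<otimes> a \<noteq> t \<otimes> a \<otimes> h"
    and B_subset: "B \<subseteq> {a, a \<otimes> h}"
    and B_nonempty: "B \<noteq> {}"
    and B_pow_5: "b \<in> B \<Longrightarrow> b \<otimes> b \<otimes> b \<otimes> b \<otimes> b = \<one>"
    and closed_5_words:
      "\<lbrakk>s0 \<in> {a, a \<otimes> h}; s1 \<in> {a, a \<otimes> h}; s2 \<in> {a, a \<otimes> h}; s3 \<in> {a, a \<otimes> h}; s4 \<in> {a, a \<otimes> h};
        s0 \<otimes> s1 \<otimes> s2 \<otimes> s3 \<otimes> s4 = \<one>\<rbrakk>
       \<Longrightarrow> s0 \<in> B \<and> s1 = s0 \<and> s2 = s0 \<and> s3 = s0 \<and> s4 = s0"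
begin

section \<open>Arcs and levels\<close>

definition arc :: "'a \<Rightarrow> 'b \<times> 'b" where
  "arc x = (v x, v (x \<otimes> a))"

definition D :: "('b \<times> 'b) set" where
  "D = arc ` carrier G"

definition oriented :: "'b pair_pre_digraph" where
  "oriented = \<lparr>pverts = v ` carrier G, parcs = D\<rparr>"

definition underlying :: "'b pair_pre_digraph" where
  "underlying = \<lparr>pverts = v ` carrier G, parcs = D \<union> D\<inverse>\<rparr>"

lemma pverts_simps [simp]: "pverts oriented = v ` carrier G" "pverts underlying = v ` carrier G"
  and parcs_simps [simp]: "parcs oriented = D" "parcs underlying = D \<union> D\<inverse>"
  by (simp_all add: oriented_def underlying_def)

lemma v_h [simp]: "x \<in> carrier G \<Longrightarrow> v (x \<otimes> h) = v x"
  by (metis v_eq_iff h_closed m_closed)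

lemma h_h_right [simp]: "x \<in> carrier G \<Longrightarrow> x \<otimes> h \<otimes> h = x"
  by (simp add: m_assoc h_h)

lemma h_h_left [simp]: "x \<in> carrier G \<Longrightarrow> h \<otimes> (h \<otimes> x) = x"
  by (simp add: m_assoc[symmetric] h_h)

text \<open>Otherwise \<open>a \<otimes> h \<otimes> inv a\<close> would be \<open>h\<close>, which
  commutes with itself.\<close>

lemma not_commute: "h \<otimes> a \<noteq> a \<otimes> h"
proof
  assume "h \<otimes> a = a \<otimes> h"
  then have "a \<otimes> h \<otimes> inv a = h"
    by (metis a_closed h_closed inv_solve_right' m_closed)
  then show False using no_alternating_4_cycle by simp
qed

lemma h_neq_one: "h \<noteq> \<one>"
  using not_commute by auto

lemma steps_closed: "s \<in> {a, a \<otimes> h} \<Longrightarrow> s \<in> carrier G"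
  by auto

text \<open>Different elements with the same tail differ by \<open>h\<close>; a common head would
  then make them equal or make \<open>h\<close> commute with \<open>a\<close>.\<close>

lemma arc_inj:
  assumes "x \<in> carrier G" "y \<in> carrier G" "v x = v y" "v (x \<otimes> a) = v (y \<otimes> a)"
  shows "x = y"
proof (rule ccontr)
  assume "x \<noteq> y"
  then have y: "y = x \<otimes> h" using assms v_eq_iff by metis
  have "y \<otimes> a = x \<otimes> a \<or> y \<otimes> a = x \<otimes> a \<otimes> h" using assms v_eq_iff by auto
  then show False
  proof
    assume "y \<otimes> a = x \<otimes> a"
    then show False using \<open>x \<noteq> y\<close> assms by simp
  next
    assume "y \<otimes> a = x \<otimes> a \<otimes> h"
    then have "x \<otimes> (h \<otimes> a) = x \<otimes> (a \<otimes> h)" using assms y by (simp add: m_assoc)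
    then show False using not_commute assms by simp
  qed
qed

lemma inj_arc: "inj_on arc (carrier G)"
  by (rule inj_onI) (auto simp: D_def arc_def intro: arc_inj)

lemma same_tail:
  assumes "x \<in> carrier G" "y \<in> carrier G" "v x = v y" "v (x \<otimes> a) \<noteq> v (y \<otimes> a)"
  shows "y = x \<otimes> h"
  using assms v_eq_iff by auto

lemma same_head:
  assumes "x \<in> carrier G" "y \<in> carrier G" "v (x \<otimes> a) = v (y \<otimes> a)" "v x \<noteq> v y"
  shows "y \<otimes> a = x \<otimes> a \<otimes> h"
proof -
  have "y \<otimes> a = x \<otimes> a \<or> y \<otimes> a = x \<otimes> a \<otimes> h"
    using assms v_eq_iff[of "x \<otimes> a" "y \<otimes> a"] by auto
  then show ?thesis using assms by auto
qed

text \<open>This turns directed walks into words: consecutive arcs differ by right multiplication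
  with a step.\<close>

lemma successive:
  assumes "x \<in> carrier G" "y \<in> carrier G" "v (x \<otimes> a) = v y"
  shows "\<exists>s\<in>{a, a \<otimes> h}. y = x \<otimes> s"
  using assms v_eq_iff[of "x \<otimes> a" y] by (auto simp: m_assoc)

text \<open>Every element has the form \<open>y \<otimes> a\<close>, so its level is a residue
  modulo 5.\<close>

lemma lev_less: "x \<in> carrier G \<Longrightarrow> lev x < 5"
  using lev_a[of "x \<otimes> inv a"] by (simp add: m_assoc)

text \<open>Levels agree on \<open>x\<close> and \<open>x \<otimes> h\<close>, so the chosen
  representative does not matter.\<close>

definition level :: "'b \<Rightarrow> nat" where
  "level w = lev (SOME x. x \<in> carrier G \<and> v x = w)"

lemma level_v: assumes "x \<in> carrier G" shows "level (v x) = lev x"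
proof -
  let ?y = "SOME y. y \<in> carrier G \<and> v y = v x"
  have "?y \<in> carrier G \<and> v ?y = v x" using assms by (metis (mono_tags, lifting) someI_ex)
  then have "lev ?y = lev x" using assms v_eq_iff[of ?y x] lev_h[of ?y] by auto
  then show ?thesis by (simp add: level_def)
qed

text \<open>The increase by one modulo 5 is split into cases without \<open>mod\<close>, which suits
  linear arithmetic.\<close>

lemma D_level:
  assumes "(p, q) \<in> D"
  shows "(level p = 4 \<and> level q = 0) \<or> (level p < 4 \<and> level q = Suc (level p))"
proof -
  obtain x where "x \<in> carrier G" "p = v x" "q = v (x \<otimes> a)" using assms by (auto simp: D_def arc_def)
  then show ?thesis using lev_less[of x] by (auto simp: level_v lev_a mod_Suc)
qed

lemma D_asym: "(p, q) \<in> D \<Longrightarrow> (q, p) \<notin> D"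
  using D_level[of p q] D_level[of q p] by auto

section \<open>Simplicity, connectedness and valency\<close>

lemma pair_graph_underlying: "pair_graph underlying"
proof
  fix e assume "e \<in> parcs underlying"
  then show "fst e \<in> pverts underlying" "snd e \<in> pverts underlying" by (auto simp: D_def arc_def)
  show "fst e \<noteq> snd e"
    using \<open>e \<in> parcs underlying\<close> D_asym[of "fst e" "fst e"] by (cases e) auto
next
  show "finite (pverts underlying)" "finite (parcs underlying)" using finite_carrier by (auto simp: D_def)
  show "symmetric underlying" by (auto simp: symmetric_def sym_def)
qed

lemma pair_wf_digraph_underlying: "pair_wf_digraph underlying"
  using pair_graph_underlying unfolding pair_graph_def pair_digraph_def pair_fin_digraph_def by auto

lemma connected_underlying: "Digraph_Component.connected (with_proj underlying)"
proof -
  let ?R = "rtrancl_on (v ` carrier G) (D \<union> D\<inverse>)"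
  have step: "(v y, v (y \<otimes> a)) \<in> ?R" "(v (y \<otimes> a), v y) \<in> ?R" if "y \<in> carrier G" for y
    using that by (auto simp: D_def arc_def intro!: rtrancl_on_into_rtrancl_on[OF rtrancl_on_refl])
  \<comment> \<open>The walk may start at any \<open>y\<close>, so that walks for two factors can be
    concatenated. Multiplication by \<open>h\<close> stays at the vertex; multiplication by
    \<open>inv a\<close> follows an arc backwards.\<close>
  have *: "x \<in> carrier G \<and> (\<forall>y\<in>carrier G. (v y, v (y \<otimes> x)) \<in> ?R)" if "x \<in> generate G {a, h}" for x
    using that
  proof induction
    case one then show ?case by auto
  next
    case (incl x) then show ?case using step by auto
  next
    case (inv x)
    have "inv h = h" using h_h by (simp add: inv_equality)
    moreover have "(v y, v (y \<otimes> inv a)) \<in> ?R" if "y \<in> carrier G" for y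
      using step(2)[of "y \<otimes> inv a"] that by (simp add: m_assoc)
    ultimately show ?case using inv by auto
  next
    case (eng x1 x2)
    then show ?case
      by (auto simp: m_assoc[symmetric]) (meson m_closed rtrancl_on_trans)
  qed
  have "(v x, v y) \<in> ?R" if "x \<in> carrier G" "y \<in> carrier G" for x y
  proof -
    have "inv x \<otimes> y \<in> generate G {a, h}" using that generated by simp
    then have "(v x, v (x \<otimes> (inv x \<otimes> y))) \<in> ?R" using * that by blast
    then show ?thesis using that by (simp add: m_assoc[symmetric])
  qed
  moreover have "mk_symmetric (with_proj underlying) = underlying"
    by (auto simp: mk_symmetric_def underlying_def)
  moreover have "pverts underlying \<noteq> {}" by auto
  ultimately show ?thesis
    unfolding Digraph_Component.connected_def strongly_connected_def
    by (auto simp: reachable_def)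
qed

text \<open>Each of the two representatives \<open>x\<close> and \<open>x \<otimes> h\<close> of the
  vertex gives one out-neighbour via \<open>a\<close> and one in-neighbour via
  \<open>inv a\<close>.\<close>

lemma out_arcs_underlying:
  assumes x: "x \<in> carrier G"
  shows "out_arcs (with_proj underlying) (v x) =
    {(v x, v (x \<otimes> a)), (v x, v (x \<otimes> h \<otimes> a)), (v x, v (x \<otimes> inv a)), (v x, v (x \<otimes> h \<otimes> inv a))}"
    (is "_ = ?R")
proof
  show "out_arcs (with_proj underlying) (v x) \<subseteq> ?R"
  proof
    fix e assume "e \<in> out_arcs (with_proj underlying) (v x)"
    then obtain w where e: "e = (v x, w)" and "(v x, w) \<in> D \<or> (w, v x) \<in> D"
      by (cases e) (auto simp: out_arcs_def)
    from this(2) show "e \<in> ?R"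
    proof
      assume "(v x, w) \<in> D"
      then obtain y where "y \<in> carrier G" "v x = v y" "w = v (y \<otimes> a)" by (auto simp: D_def arc_def)
      then show ?thesis using e x v_eq_iff[of x y] by auto
    next
      assume "(w, v x) \<in> D"
      then obtain y where y: "y \<in> carrier G" "v x = v (y \<otimes> a)" "w = v y" by (auto simp: D_def arc_def)
      then have "y \<otimes> a = x \<or> y \<otimes> a = x \<otimes> h" using x v_eq_iff[of x "y \<otimes> a"] by auto
      then have "y = x \<otimes> inv a \<or> y = x \<otimes> h \<otimes> inv a" using x y
        by (metis a_closed h_closed inv_solve_right m_closed)
      then show ?thesis using e y by auto
    qed
  qed
  have "arc x \<in> D" "arc (x \<otimes> h) \<in> D" "arc (x \<otimes> inv a) \<in> D" "arc (x \<otimes> h \<otimes> inv a) \<in> D"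
    using x by (auto simp: D_def)
  moreover have "x \<otimes> inv a \<otimes> a = x" "x \<otimes> h \<otimes> inv a \<otimes> a = x \<otimes> h" using x by (auto simp: m_assoc)
  ultimately show "?R \<subseteq> out_arcs (with_proj underlying) (v x)"
    using x by (auto simp: out_arcs_def D_def arc_def)
qed

text \<open>The two out-neighbours differ, and so do the two in-neighbours, since an arc determines
  its group element; asymmetry of \<open>D\<close> separates the former from the latter.\<close>

lemma regular_underlying: "regular_of_valency 4 underlying"
  unfolding regular_of_valency_def
proof
  fix w assume "w \<in> pverts underlying"
  then obtain x where x: "x \<in> carrier G" and w: "w = v x" by auto
  have 1: "v (x \<otimes> a) \<noteq> v (x \<otimes> h \<otimes> a)"
    using arc_inj[of x "x \<otimes> h"] x h_neq_one by auto
  have 2: "v (x \<otimes> inv a) \<noteq> v (x \<otimes> h \<otimes> inv a)"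
  proof
    assume "v (x \<otimes> inv a) = v (x \<otimes> h \<otimes> inv a)"
    then have "x \<otimes> inv a = x \<otimes> h \<otimes> inv a"
      using arc_inj[of "x \<otimes> inv a" "x \<otimes> h \<otimes> inv a"] x by (simp add: m_assoc)
    then show False using x h_neq_one by auto
  qed
  have up: "(v x, v (x \<otimes> a)) \<in> D" "(v x, v (x \<otimes> h \<otimes> a)) \<in> D"
    using x imageI[of x "carrier G" arc] imageI[of "x \<otimes> h" "carrier G" arc] by (auto simp: D_def arc_def)
  have down: "(v (x \<otimes> inv a), v x) \<in> D" "(v (x \<otimes> h \<otimes> inv a), v x) \<in> D"
    using x imageI[of "x \<otimes> inv a" "carrier G" arc] imageI[of "x \<otimes> h \<otimes> inv a" "carrier G" arc]
    by (auto simp: D_def arc_def m_assoc)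
  have "q \<noteq> p" if "(v x, q) \<in> D" "(p, v x) \<in> D" for p q
    using that D_asym by auto
  then have 3: "v (x \<otimes> a) \<noteq> v (x \<otimes> inv a)" "v (x \<otimes> a) \<noteq> v (x \<otimes> h \<otimes> inv a)"
    "v (x \<otimes> h \<otimes> a) \<noteq> v (x \<otimes> inv a)" "v (x \<otimes> h \<otimes> a) \<noteq> v (x \<otimes> h \<otimes> inv a)"
    using up down by auto
  show "out_degree (with_proj underlying) w = 4"
    using 1 2 3 by (simp add: out_degree_def w out_arcs_underlying[OF x])
qed

section \<open>Excluding cycles of length 3 and 4\<close>

text \<open>Going round, arcs with a common tail differ by \<open>h\<close> and arcs with a common
  head by \<open>a \<otimes> h \<otimes> inv a\<close>; closing up makes these two commute.\<close>

lemma no_4_cycle_alternating: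
  assumes "(p, m) \<in> D" "(q, m) \<in> D" "(q, n) \<in> D" "(p, n) \<in> D" "p \<noteq> q" "m \<noteq> n"
  shows False
proof -
  obtain x where x: "x \<in> carrier G" "p = v x" "m = v (x \<otimes> a)" using assms(1) by (auto simp: D_def arc_def)
  obtain y where y: "y \<in> carrier G" "q = v y" "m = v (y \<otimes> a)" using assms(2) by (auto simp: D_def arc_def)
  obtain z where z: "z \<in> carrier G" "q = v z" "n = v (z \<otimes> a)" using assms(3) by (auto simp: D_def arc_def)
  obtain u where u: "u \<in> carrier G" "p = v u" "n = v (u \<otimes> a)" using assms(4) by (auto simp: D_def arc_def)
  have u': "u = x \<otimes> h" and z': "z = y \<otimes> h"
    using same_tail[of x u] same_tail[of y z] x y z u assms(6) by auto
  have "y \<otimes> a = x \<otimes> a \<otimes> h" and *: "u \<otimes> a = z \<otimes> a \<otimes> h"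
    using same_head[of x y] same_head[of z u] x y z u assms(5) by auto
  then have y': "y = x \<otimes> a \<otimes> h \<otimes> inv a"
    using x y by (metis a_closed h_closed inv_solve_right m_closed)
  have "x \<otimes> (h \<otimes> a) = x \<otimes> (a \<otimes> h \<otimes> inv a \<otimes> h \<otimes> a \<otimes> h)"
    using * x by (simp only: u' z' y' m_assoc m_closed inv_closed a_closed h_closed)
  then have "h \<otimes> a = a \<otimes> h \<otimes> inv a \<otimes> h \<otimes> a \<otimes> h"
    using x by (simp del: h_h_right)
  \<comment> \<open>Cancelling the final \<open>a \<otimes> h\<close> leaves the excluded
    commutation.\<close>
  then have "h \<otimes> a \<otimes> (h \<otimes> inv a) = a \<otimes> h \<otimes> inv a \<otimes> h \<otimes> a \<otimes> h \<otimes> (h \<otimes> inv a)"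
    by (rule arg_cong)
  also have "\<dots> = a \<otimes> h \<otimes> inv a \<otimes> h" by (simp add: m_assoc)
  finally show False using no_alternating_4_cycle by (simp add: m_assoc)
qed

text \<open>The two paths start with \<open>x\<close> and \<open>x \<otimes> h\<close>. Their last
  arcs share a head, which gives the relation excluded by
  \<open>no_parallel_4_cycle\<close>.\<close>

lemma no_4_cycle_parallel:
  assumes "(p, m) \<in> D" "(m, q) \<in> D" "(p, n) \<in> D" "(n, q) \<in> D" "m \<noteq> n"
  shows False
proof -
  obtain x where x: "x \<in> carrier G" "p = v x" "m = v (x \<otimes> a)" using assms(1) by (auto simp: D_def arc_def)
  obtain y where y: "y \<in> carrier G" "m = v y" "q = v (y \<otimes> a)" using assms(2) by (auto simp: D_def arc_def)
  obtain u where u: "u \<in> carrier G" "p = v u" "n = v (u \<otimes> a)" using assms(3) by (auto simp: D_def arc_def)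
  obtain z where z: "z \<in> carrier G" "n = v z" "q = v (z \<otimes> a)" using assms(4) by (auto simp: D_def arc_def)
  have u': "u = x \<otimes> h" using same_tail[of x u] x u assms(5) by auto
  obtain s where s: "s \<in> {a, a \<otimes> h}" "y = x \<otimes> s" using successive[of x y] x y by auto
  obtain t where t: "t \<in> {a, a \<otimes> h}" "z = x \<otimes> h \<otimes> t" using successive[of u z] u u' z by auto
  have "z \<otimes> a = y \<otimes> a \<otimes> h" using same_head[of y z] y z assms(5) by auto
  then have "x \<otimes> (h \<otimes> t \<otimes> a) = x \<otimes> (s \<otimes> a \<otimes> h)"
    using x s t steps_closed by (simp add: m_assoc)
  then show False using no_parallel_4_cycle[OF t(1) s(1)] x steps_closed[OF s(1)] steps_closed[OF t(1)]
    by simp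
qed

lemma adjacent_level:
  assumes "(p, q) \<in> D \<or> (q, p) \<in> D"
  shows "(level p = 4 \<and> level q = 0) \<or> (level p < 4 \<and> level q = Suc (level p)) \<or>
    (level q = 4 \<and> level p = 0) \<or> (level q < 4 \<and> level p = Suc (level q))"
  using assms D_level by blast

lemma no_cycle_3:
  assumes "cycle_walk underlying p" shows "length p \<noteq> 3"
proof
  assume "length p = 3"
  then obtain w0 w1 w2 where
    "(w0, w1) \<in> D \<or> (w1, w0) \<in> D" "(w1, w2) \<in> D \<or> (w2, w1) \<in> D" "(w2, w0) \<in> D \<or> (w0, w2) \<in> D"
    by (rule cycle_walk_3E[OF pair_wf_digraph_underlying assms]) auto
  \<comment> \<open>Three level changes by 1 or -1 never sum to a multiple of 5.\<close>
  from this[THEN adjacent_level] show False by (elim disjE conjE; linarith)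
qed

text \<open>Three arcs raise the level by 3, and a single edge cannot make up for that modulo
  5.\<close>

lemma no_directed_path_3:
  assumes "(p, q) \<in> D" "(q, r) \<in> D" "(r, s) \<in> D"
  shows "(s, p) \<notin> D" "(p, s) \<notin> D"
  using assms[THEN D_level] D_level[of s p] D_level[of p s] by (safe; linarith)+

lemma no_cycle_4:
  assumes "cycle_walk underlying p" shows "length p \<noteq> 4"
proof
  assume "length p = 4"
  then obtain w0 w1 w2 w3 where w:
    "(w0, w1) \<in> D \<or> (w1, w0) \<in> D" "(w1, w2) \<in> D \<or> (w2, w1) \<in> D"
    "(w2, w3) \<in> D \<or> (w3, w2) \<in> D" "(w3, w0) \<in> D \<or> (w0, w3) \<in> D" "w0 \<noteq> w2" "w1 \<noteq> w3"
    by (rule cycle_walk_4E[OF pair_wf_digraph_underlying assms]) auto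
  \<comment> \<open>Of the 16 orientations of a 4-cycle, 10 contain a directed path of length 3; the
    others are two directed paths of length 2 (4 cases) or alternate (2 cases).\<close>
  note path = no_directed_path_3[of w0 w1 w2 w3] no_directed_path_3[of w1 w2 w3 w0]
    no_directed_path_3[of w2 w3 w0 w1] no_directed_path_3[of w3 w0 w1 w2]
    no_directed_path_3[of w3 w2 w1 w0] no_directed_path_3[of w2 w1 w0 w3]
    no_directed_path_3[of w1 w0 w3 w2] no_directed_path_3[of w0 w3 w2 w1]
  note parallel = no_4_cycle_parallel[of w0 w1 w2 w3] no_4_cycle_parallel[of w1 w2 w3 w0]
    no_4_cycle_parallel[of w2 w3 w0 w1] no_4_cycle_parallel[of w3 w0 w1 w2]
  note alternating = no_4_cycle_alternating[of w0 w1 w2 w3] no_4_cycle_alternating[of w1 w0 w3 w2]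
  show False
    using w path parallel alternating by argo
qed

section \<open>Counting the 5-cycles\<close>

lemma inj_edge_of_arc: "inj_on (\<lambda>x. edge_of (arc x)) (carrier G)"
proof (rule inj_onI)
  fix x y assume x: "x \<in> carrier G" and y: "y \<in> carrier G" and eq: "edge_of (arc x) = edge_of (arc y)"
  have D: "arc x \<in> D" "arc y \<in> D" using x y by (auto simp: D_def)
  then have "arc x = arc y"
    using eq D_asym by (auto simp: arc_def doubleton_eq_iff)
  then show "x = y" using inj_arc x y by (auto dest: inj_onD)
qed

text \<open>The sign \<open>d\<close> records the direction of the edge, and the integer differences
  telescope around a closed walk.\<close>

lemma adjacent_level_int:
  assumes "(p, q) \<in> D \<or> (q, p) \<in> D"
  obtains d :: int where "5 dvd (int (level q) - int (level p) - d)"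
    "(d = 1 \<and> (p, q) \<in> D) \<or> (d = -1 \<and> (q, p) \<in> D)"
proof -
  have *: "5 dvd (int (level q) - int (level p) - 1)" if "(p, q) \<in> D" for p q
    using D_level[OF that] by auto
  have "5 dvd (int (level q) - int (level p) - (-1))" if "(q, p) \<in> D"
    using *[OF that] by (simp add: dvd_diff_commute algebra_simps)
  then show thesis using * that assms by blast
qed

text \<open>Five signs with sum divisible by 5 are all equal, because the sum is odd and at most 5
  in absolute value.\<close>

lemma closed_5_walk_directed:
  assumes "(w0, w1) \<in> D \<or> (w1, w0) \<in> D" "(w1, w2) \<in> D \<or> (w2, w1) \<in> D"
    "(w2, w3) \<in> D \<or> (w3, w2) \<in> D" "(w3, w4) \<in> D \<or> (w4, w3) \<in> D" "(w4, w0) \<in> D \<or> (w0, w4) \<in> D"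
  shows "(w0, w1) \<in> D \<and> (w1, w2) \<in> D \<and> (w2, w3) \<in> D \<and> (w3, w4) \<in> D \<and> (w4, w0) \<in> D \<or>
    (w1, w0) \<in> D \<and> (w2, w1) \<in> D \<and> (w3, w2) \<in> D \<and> (w4, w3) \<in> D \<and> (w0, w4) \<in> D"
proof -
  let ?l = "\<lambda>w. int (level w)"
  obtain d0 :: int where d0: "5 dvd (?l w1 - ?l w0 - d0)" "(d0 = 1 \<and> (w0, w1) \<in> D) \<or> (d0 = -1 \<and> (w1, w0) \<in> D)"
    using adjacent_level_int[OF assms(1)] by blast
  obtain d1 :: int where d1: "5 dvd (?l w2 - ?l w1 - d1)" "(d1 = 1 \<and> (w1, w2) \<in> D) \<or> (d1 = -1 \<and> (w2, w1) \<in> D)"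
    using adjacent_level_int[OF assms(2)] by blast
  obtain d2 :: int where d2: "5 dvd (?l w3 - ?l w2 - d2)" "(d2 = 1 \<and> (w2, w3) \<in> D) \<or> (d2 = -1 \<and> (w3, w2) \<in> D)"
    using adjacent_level_int[OF assms(3)] by blast
  obtain d3 :: int where d3: "5 dvd (?l w4 - ?l w3 - d3)" "(d3 = 1 \<and> (w3, w4) \<in> D) \<or> (d3 = -1 \<and> (w4, w3) \<in> D)"
    using adjacent_level_int[OF assms(4)] by blast
  obtain d4 :: int where d4: "5 dvd (?l w0 - ?l w4 - d4)" "(d4 = 1 \<and> (w4, w0) \<in> D) \<or> (d4 = -1 \<and> (w0, w4) \<in> D)"
    using adjacent_level_int[OF assms(5)] by blast
  have "5 dvd ((?l w1 - ?l w0 - d0) + (?l w2 - ?l w1 - d1) + (?l w3 - ?l w2 - d2)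
      + (?l w4 - ?l w3 - d3) + (?l w0 - ?l w4 - d4))"
    by (intro dvd_add d0(1) d1(1) d2(1) d3(1) d4(1))
  also have "\<dots> = - (d0 + d1 + d2 + d3 + d4)" by simp
  finally have "5 dvd (d0 + d1 + d2 + d3 + d4)" by (simp only: dvd_minus_iff)
  then show ?thesis
    using d0(2) d1(2) d2(2) d3(2) d4(2) by (elim disjE conjE; simp)
qed

text \<open>For \<open>b \<in> B\<close> these are the edges belonging to the left coset of
  \<open>x\<close> modulo the cyclic group generated by \<open>b\<close>.\<close>

definition orbit_cycle :: "'a \<Rightarrow> 'a \<Rightarrow> 'b set set" where
  "orbit_cycle b x = (\<lambda>y. edge_of (arc y)) `
     {x, x \<otimes> b, x \<otimes> b \<otimes> b, x \<otimes> b \<otimes> b \<otimes> b, x \<otimes> b \<otimes> b \<otimes> b \<otimes> b}"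

text \<open>The steps between consecutive arcs multiply to \<open>\<one>\<close>, so by
  \<open>closed_5_words\<close> they are all the same element of \<open>B\<close>.\<close>

lemma directed_5_cycle_edges:
  assumes "(w0, w1) \<in> D" "(w1, w2) \<in> D" "(w2, w3) \<in> D" "(w3, w4) \<in> D" "(w4, w0) \<in> D"
  shows "\<exists>b\<in>B. \<exists>x\<in>carrier G. {{w0, w1}, {w1, w2}, {w2, w3}, {w3, w4}, {w4, w0}} = orbit_cycle b x"
proof -
  obtain x0 where x0: "x0 \<in> carrier G" "w0 = v x0" "w1 = v (x0 \<otimes> a)" using assms(1) by (auto simp: D_def arc_def)
  obtain x1 where x1: "x1 \<in> carrier G" "w1 = v x1" "w2 = v (x1 \<otimes> a)" using assms(2) by (auto simp: D_def arc_def)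
  obtain x2 where x2: "x2 \<in> carrier G" "w2 = v x2" "w3 = v (x2 \<otimes> a)" using assms(3) by (auto simp: D_def arc_def)
  obtain x3 where x3: "x3 \<in> carrier G" "w3 = v x3" "w4 = v (x3 \<otimes> a)" using assms(4) by (auto simp: D_def arc_def)
  obtain x4 where x4: "x4 \<in> carrier G" "w4 = v x4" "w0 = v (x4 \<otimes> a)" using assms(5) by (auto simp: D_def arc_def)
  obtain s0 where s0: "s0 \<in> {a, a \<otimes> h}" "x1 = x0 \<otimes> s0" using successive[of x0 x1] x0 x1 by auto
  obtain s1 where s1: "s1 \<in> {a, a \<otimes> h}" "x2 = x1 \<otimes> s1" using successive[of x1 x2] x1 x2 by auto
  obtain s2 where s2: "s2 \<in> {a, a \<otimes> h}" "x3 = x2 \<otimes> s2" using successive[of x2 x3] x2 x3 by auto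
  obtain s3 where s3: "s3 \<in> {a, a \<otimes> h}" "x4 = x3 \<otimes> s3" using successive[of x3 x4] x3 x4 by auto
  obtain s4 where s4: "s4 \<in> {a, a \<otimes> h}" "x0 = x4 \<otimes> s4" using successive[of x4 x0] x4 x0 by auto
  note closed = steps_closed[OF s0(1)] steps_closed[OF s1(1)] steps_closed[OF s2(1)]
    steps_closed[OF s3(1)] steps_closed[OF s4(1)]
  have "x0 \<otimes> (s0 \<otimes> s1 \<otimes> s2 \<otimes> s3 \<otimes> s4) = x0 \<otimes> s0 \<otimes> s1 \<otimes> s2 \<otimes> s3 \<otimes> s4"
    using closed x0(1) by (simp add: m_assoc)
  also have "\<dots> = x0" using s0(2) s1(2) s2(2) s3(2) s4(2) by metis
  finally have "s0 \<otimes> s1 \<otimes> s2 \<otimes> s3 \<otimes> s4 = \<one>"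
    using closed x0(1) by (simp del: h_h_right)
  then have "s0 \<in> B \<and> s1 = s0 \<and> s2 = s0 \<and> s3 = s0 \<and> s4 = s0"
    by (rule closed_5_words[OF s0(1) s1(1) s2(1) s3(1) s4(1)])
  moreover have "{{w0, w1}, {w1, w2}, {w2, w3}, {w3, w4}, {w4, w0}} =
      (\<lambda>y. edge_of (arc y)) ` {x0, x1, x2, x3, x4}"
    using x0(2,3) x1(2,3) x2(2,3) x3(2,3) x4(2,3) by (simp add: arc_def)
  ultimately show ?thesis
    using x0(1) s0(2) s1(2) s2(2) s3(2) unfolding orbit_cycle_def by metis
qed

lemma lev_step: "\<lbrakk>x \<in> carrier G; s \<in> {a, a \<otimes> h}\<rbrakk> \<Longrightarrow> lev (x \<otimes> s) = Suc (lev x) mod 5"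
  using lev_a[of x] lev_h[of "x \<otimes> a"] by (auto simp: m_assoc)

lemma v_step: "\<lbrakk>x \<in> carrier G; s \<in> {a, a \<otimes> h}\<rbrakk> \<Longrightarrow> v (x \<otimes> s) = v (x \<otimes> a)"
  using v_h[of "x \<otimes> a"] by (auto simp: m_assoc)

lemma B_steps: "b \<in> B \<Longrightarrow> b \<in> {a, a \<otimes> h}"
  using B_subset by blast

lemma B_closed: "b \<in> B \<Longrightarrow> b \<in> carrier G"
  using B_steps steps_closed by blast

lemma mult_B_5:
  assumes "b \<in> B" "x \<in> carrier G"
  shows "x \<otimes> b \<otimes> b \<otimes> b \<otimes> b \<otimes> b = x"
proof -
  have "x \<otimes> b \<otimes> b \<otimes> b \<otimes> b \<otimes> b = x \<otimes> (b \<otimes> b \<otimes> b \<otimes> b \<otimes> b)"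
    using B_closed[OF assms(1)] assms(2) by (simp add: m_assoc)
  then show ?thesis using B_pow_5 assms by simp
qed

lemma lev_orbit:
  assumes "b \<in> B" "x \<in> carrier G"
  shows "lev (x \<otimes> b) = (lev x + 1) mod 5" "lev (x \<otimes> b \<otimes> b) = (lev x + 2) mod 5"
    "lev (x \<otimes> b \<otimes> b \<otimes> b) = (lev x + 3) mod 5" "lev (x \<otimes> b \<otimes> b \<otimes> b \<otimes> b) = (lev x + 4) mod 5"
  using assms B_closed[OF assms(1)] by (simp_all add: lev_step[OF _ B_steps] mod_simps add.commute)

lemma orbit_cycle_walk:
  assumes b: "b \<in> B" and x: "x \<in> carrier G"
  shows "\<exists>p. cycle_walk underlying p \<and> length p = 5 \<and> edge_of ` set p = orbit_cycle b x"
proof -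
  note bc = B_closed[OF b] and vs = v_step[OF _ B_steps[OF b]]
  define x1 x2 x3 x4 where xs: "x1 = x \<otimes> b" "x2 = x1 \<otimes> b" "x3 = x2 \<otimes> b" "x4 = x3 \<otimes> b"
  have c: "x1 \<in> carrier G" "x2 \<in> carrier G" "x3 \<in> carrier G" "x4 \<in> carrier G"
    using x bc by (auto simp: xs)
  have x0: "x4 \<otimes> b = x" using mult_B_5[OF b x] by (simp add: xs)
  have arcs: "arc x = (v x, v x1)" "arc x1 = (v x1, v x2)" "arc x2 = (v x2, v x3)"
    "arc x3 = (v x3, v x4)" "arc x4 = (v x4, v x)"
    using x c vs[of x] vs[of x1] vs[of x2] vs[of x3] vs[of x4] by (auto simp: arc_def xs(1-4)[symmetric] x0)
  \<comment> \<open>The levels of the five vertices run through all residues modulo 5, which keeps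
    the vertices apart.\<close>
  have "distinct (map lev [x, x1, x2, x3, x4])"
    using residues_distinct[OF lev_less[OF x]] lev_orbit[OF b x] by (simp add: xs)
  then have "distinct (map level [v x, v x1, v x2, v x3, v x4])"
    using x c by (simp add: level_v)
  then have "distinct [v x, v x1, v x2, v x3, v x4]" using distinct_map by blast
  moreover have "set [arc x, arc x1, arc x2, arc x3, arc x4] \<subseteq> parcs underlying"
    using x c by (auto simp: D_def)
  ultimately have "cycle_walk underlying [arc x, arc x1, arc x2, arc x3, arc x4] \<and>
      length [arc x, arc x1, arc x2, arc x3, arc x4] = 5"
    unfolding cycle_walk_5_iff[OF pair_wf_digraph_underlying] arcs by blast
  moreover have "edge_of ` set [arc x, arc x1, arc x2, arc x3, arc x4] = orbit_cycle b x"
    by (simp add: orbit_cycle_def xs)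
  ultimately show ?thesis by blast
qed

lemma cycles_of_length_5: "cycles_of_length 5 underlying = {orbit_cycle b x | b x. b \<in> B \<and> x \<in> carrier G}"
proof (intro subset_antisym subsetI)
  fix C assume "C \<in> cycles_of_length 5 underlying"
  then obtain p where p: "cycle_walk underlying p \<and> length p = 5" and C: "C = edge_of ` set p"
    by (auto simp: cycles_of_length_def)
  then obtain w0 w1 w2 w3 w4 where pw: "p = [(w0, w1), (w1, w2), (w2, w3), (w3, w4), (w4, w0)]"
    and "set p \<subseteq> parcs underlying"
    unfolding cycle_walk_5_iff[OF pair_wf_digraph_underlying] by blast
  then have "(w0, w1) \<in> D \<or> (w1, w0) \<in> D" "(w1, w2) \<in> D \<or> (w2, w1) \<in> D"
    "(w2, w3) \<in> D \<or> (w3, w2) \<in> D" "(w3, w4) \<in> D \<or> (w4, w3) \<in> D" "(w4, w0) \<in> D \<or> (w0, w4) \<in> D"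
    by auto
  from closed_5_walk_directed[OF this]
  have "\<exists>b\<in>B. \<exists>x\<in>carrier G. {{w0, w1}, {w1, w2}, {w2, w3}, {w3, w4}, {w4, w0}} = orbit_cycle b x"
  proof (elim disjE conjE)
    \<comment> \<open>A cycle traversed against the orientation has the same edges when read
      backwards.\<close>
    assume "(w1, w0) \<in> D" "(w2, w1) \<in> D" "(w3, w2) \<in> D" "(w4, w3) \<in> D" "(w0, w4) \<in> D"
    then have "\<exists>b\<in>B. \<exists>x\<in>carrier G. {{w0, w4}, {w4, w3}, {w3, w2}, {w2, w1}, {w1, w0}} = orbit_cycle b x"
      by (intro directed_5_cycle_edges)
    moreover have "{{w0, w4}, {w4, w3}, {w3, w2}, {w2, w1}, {w1, w0}} =
        {{w0, w1}, {w1, w2}, {w2, w3}, {w3, w4}, {w4, w0}}"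
      by (simp add: insert_commute)
    ultimately show ?thesis by simp
  qed (rule directed_5_cycle_edges)
  then show "C \<in> {orbit_cycle b x | b x. b \<in> B \<and> x \<in> carrier G}"
    using C pw by auto
next
  fix C assume "C \<in> {orbit_cycle b x | b x. b \<in> B \<and> x \<in> carrier G}"
  then obtain b x where "b \<in> B" "x \<in> carrier G" "C = orbit_cycle b x" by blast
  then show "C \<in> cycles_of_length 5 underlying"
    using orbit_cycle_walk[of b x] unfolding cycles_of_length_def by blast
qed

lemma orbit_cycle_shift:
  assumes "b \<in> B" "x \<in> carrier G"
  shows "orbit_cycle b (x \<otimes> b) = orbit_cycle b x"
  unfolding orbit_cycle_def mult_B_5[OF assms] by (rule arg_cong[where f = "image _"]) auto

text \<open>The edge determines \<open>x\<close>, which therefore lies in the coset of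
  \<open>y\<close>; a coset may be started at any of its elements.\<close>

lemma edge_in_orbit_cycle:
  assumes b: "b \<in> B" and x: "x \<in> carrier G" and y: "y \<in> carrier G"
    and e: "edge_of (arc x) \<in> orbit_cycle b y"
  shows "orbit_cycle b y = orbit_cycle b x"
proof -
  note bc = B_closed[OF b]
  have "x \<in> {y, y \<otimes> b, y \<otimes> b \<otimes> b, y \<otimes> b \<otimes> b \<otimes> b, y \<otimes> b \<otimes> b \<otimes> b \<otimes> b}"
    using e x y bc unfolding orbit_cycle_def
    by (subst (asm) inj_on_image_mem_iff[OF inj_edge_of_arc]) auto
  then show ?thesis using orbit_cycle_shift[OF b] y bc by auto
qed

text \<open>\<open>x \<otimes> c\<close> lies among the
  \<open>x \<otimes> b \<otimes> \<dots> \<otimes> b\<close>, and its level leaves only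
  \<open>x \<otimes> b\<close>.\<close>

lemma orbit_cycle_inj:
  assumes b: "b \<in> B" and c: "c \<in> B" and x: "x \<in> carrier G"
    and e: "orbit_cycle b x = orbit_cycle c x"
  shows "b = c"
proof -
  note bc = B_closed[OF b] B_closed[OF c]
  have "edge_of (arc (x \<otimes> c)) \<in> orbit_cycle b x" unfolding e by (simp add: orbit_cycle_def)
  then have "x \<otimes> c \<in> {x, x \<otimes> b, x \<otimes> b \<otimes> b, x \<otimes> b \<otimes> b \<otimes> b, x \<otimes> b \<otimes> b \<otimes> b \<otimes> b}"
    using x bc unfolding orbit_cycle_def
    by (subst (asm) inj_on_image_mem_iff[OF inj_edge_of_arc]) auto
  moreover have "lev (x \<otimes> c) = (lev x + 1) mod 5" using lev_orbit[OF c x] by simp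
  ultimately have "x \<otimes> c = x \<otimes> b"
    using residues_distinct[OF lev_less[OF x]] lev_orbit[OF b x] by fastforce
  then show ?thesis using bc x by simp
qed

lemma each_edge_on_cycles_underlying: "each_edge_on_cycles (card B) 5 underlying"
  unfolding each_edge_on_cycles_def
proof
  fix e assume "e \<in> edges underlying"
  then obtain x where x: "x \<in> carrier G" and e: "e = edge_of (arc x)"
    by (auto simp: edges_def D_def arc_def insert_commute)
  have "{C \<in> cycles_of_length 5 underlying. e \<in> C} = (\<lambda>b. orbit_cycle b x) ` B"
  proof (intro subset_antisym subsetI)
    fix C assume "C \<in> {C \<in> cycles_of_length 5 underlying. e \<in> C}"
    then obtain b y where "b \<in> B" "y \<in> carrier G" "C = orbit_cycle b y" "e \<in> C"
      unfolding cycles_of_length_5 by blast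
    then show "C \<in> (\<lambda>b. orbit_cycle b x) ` B"
      using edge_in_orbit_cycle[of b x y] x e by auto
  next
    fix C assume "C \<in> (\<lambda>b. orbit_cycle b x) ` B"
    then show "C \<in> {C \<in> cycles_of_length 5 underlying. e \<in> C}"
      unfolding cycles_of_length_5 using x e by (auto simp: orbit_cycle_def)
  qed
  moreover have "inj_on (\<lambda>b. orbit_cycle b x) B"
    by (rule inj_onI) (rule orbit_cycle_inj[OF _ _ x])
  ultimately show "card {C \<in> cycles_of_length 5 underlying. e \<in> C} = card B"
    by (simp add: card_image)
qed

lemma girth_underlying: "girth underlying = 5"
proof -
  obtain b where "b \<in> B" using B_nonempty by blast
  then obtain p where p: "cycle_walk underlying p" "length p = 5"
    using orbit_cycle_walk[of b \<one>] by auto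
  have "enat 5 \<le> enat (length q)" if "cycle_walk underlying q" for q
  proof -
    have "3 \<le> length q" using that by (simp add: cycle_walk_def)
    then show ?thesis using no_cycle_3[OF that] no_cycle_4[OF that] by simp
  qed
  then have "girth underlying = enat 5"
    unfolding girth_def using p
    by (intro antisym INF_greatest) (auto intro: INF_lower2[of p])
  then show ?thesis by (simp add: numeral_eq_enat)
qed

section \<open>Left translations and half-arc-transitivity\<close>

text \<open>Left multiplication respects the cosets of \<open>h\<close>, so any representative
  serves. The restriction is there because elements of \<open>Bij\<close> are extensional.\<close>

definition translation :: "'a \<Rightarrow> 'b \<Rightarrow> 'b" where
  "translation g = (\<lambda>w\<in>v ` carrier G. v (g \<otimes> (SOME x. x \<in> carrier G \<and> v x = w)))"

lemma translation_v:
  assumes "g \<in> carrier G" "x \<in> carrier G"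
  shows "translation g (v x) = v (g \<otimes> x)"
proof -
  let ?y = "SOME y. y \<in> carrier G \<and> v y = v x"
  have y: "?y \<in> carrier G \<and> v ?y = v x" using assms by (metis (mono_tags, lifting) someI_ex)
  then have "x = ?y \<or> x = ?y \<otimes> h" using assms v_eq_iff[of ?y x] by simp
  then have "v (g \<otimes> ?y) = v (g \<otimes> x)"
  proof
    assume "x = ?y \<otimes> h"
    then have "v (g \<otimes> x) = v (g \<otimes> ?y \<otimes> h)" using assms y by (simp add: m_assoc)
    then show ?thesis using assms y by simp
  qed simp
  then show ?thesis using assms by (simp add: translation_def)
qed

lemma translation_arc:
  assumes g: "g \<in> carrier G" and D: "(p, q) \<in> D"
  shows "(translation g p, translation g q) \<in> D"
proof -
  obtain x where "x \<in> carrier G" "(p, q) = arc x" using D by (auto simp: D_def)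
  then have "(translation g p, translation g q) = arc (g \<otimes> x)" "g \<otimes> x \<in> carrier G"
    using g by (auto simp: arc_def translation_v m_assoc)
  then show ?thesis by (simp add: D_def)
qed

lemma translation_inv:
  assumes "g \<in> carrier G" "w \<in> v ` carrier G"
  shows "translation (inv g) (translation g w) = w" "translation g (translation (inv g) w) = w"
  using assms by (auto simp: translation_v m_assoc[symmetric])

lemma translation_automorphism:
  assumes g: "g \<in> carrier G"
  shows "translation g \<in> graph_automorphisms oriented"
proof -
  have "bij_betw (translation g) (v ` carrier G) (v ` carrier G)"
    by (rule bij_betw_byWitness[where f' = "translation (inv g)"])
      (use g translation_inv[OF g] in \<open>auto simp: translation_v\<close>)
  then have "translation g \<in> Bij (v ` carrier G)"
    by (simp add: Bij_def translation_def)
  moreover have "(translation g p, translation g q) \<in> D \<longleftrightarrow> (p, q) \<in> D"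
    if "p \<in> v ` carrier G" "q \<in> v ` carrier G" for p q
    using translation_arc[OF g, of p q] translation_arc[of "inv g" "translation g p" "translation g q"]
      translation_inv(1)[OF g] that g by auto
  ultimately show ?thesis by (simp add: graph_automorphisms_def)
qed

lemma automorphisms_oriented_subset: "graph_automorphisms oriented \<subseteq> graph_automorphisms underlying"
  by (auto simp: graph_automorphisms_def)

text \<open>Both graphs have the same vertices, so both automorphism groups carry the operation of
  one \<open>BijGroup\<close>, and inclusion suffices.\<close>

lemma subgroup_automorphisms_oriented:
  "subgroup (graph_automorphisms oriented) (Aut_graph underlying)"
proof -
  have eq: "Aut_graph underlying\<lparr>carrier := graph_automorphisms oriented\<rparr> = Aut_graph oriented"
    by (simp add: Aut_graph_def)
  show ?thesis
    by (rule group.group_incl_imp_subgroup[OF group_Aut_graph])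
      (use automorphisms_oriented_subset in \<open>auto simp: eq group_Aut_graph, simp add: Aut_graph_def subset_iff\<close>)
qed

text \<open>The group consists of all orientation-preserving automorphisms. It contains the left
  translations, and none of its elements reverses an arc.\<close>

lemma half_arc_transitive_underlying:
  "half_arc_transitive (graph_automorphisms oriented) underlying"
  unfolding half_arc_transitive_def
proof (intro conjI)
  have move: "\<exists>g\<in>carrier G. y = g \<otimes> x" if "x \<in> carrier G" "y \<in> carrier G" for x y
    using that by (intro bexI[of _ "y \<otimes> inv x"]) (auto simp: m_assoc)
  show "subgroup (graph_automorphisms oriented) (Aut_graph underlying)"
    by (rule subgroup_automorphisms_oriented)
  show "transitive_via (\<lambda>g v. g v) (graph_automorphisms oriented) (pverts underlying)"
    unfolding transitive_via_def
  proof (intro ballI)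
    fix p q assume "p \<in> pverts underlying" "q \<in> pverts underlying"
    then obtain x y where xy: "x \<in> carrier G" "p = v x" "y \<in> carrier G" "q = v y" by auto
    then obtain g where "g \<in> carrier G" "y = g \<otimes> x" using move by blast
    then show "\<exists>g\<in>graph_automorphisms oriented. g p = q"
      using xy translation_automorphism translation_v by metis
  qed
  show "transitive_via (\<lambda>g e. g ` e) (graph_automorphisms oriented) (edges underlying)"
    unfolding transitive_via_def
  proof (intro ballI)
    fix e f assume "e \<in> edges underlying" "f \<in> edges underlying"
    then obtain x y where xy: "x \<in> carrier G" "e = {v x, v (x \<otimes> a)}" "y \<in> carrier G" "f = {v y, v (y \<otimes> a)}"
      by (auto simp: edges_def D_def arc_def insert_commute)
    then obtain g where g: "g \<in> carrier G" "y = g \<otimes> x" using move by blast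
    have "translation g ` e = f" using g xy by (simp add: translation_v m_assoc)
    then show "\<exists>g\<in>graph_automorphisms oriented. g ` e = f"
      using translation_automorphism g by blast
  qed
  show "\<not> transitive_via (\<lambda>g a. (g (fst a), g (snd a))) (graph_automorphisms oriented) (parcs underlying)"
  proof
    assume tr: "transitive_via (\<lambda>g a. (g (fst a), g (snd a))) (graph_automorphisms oriented) (parcs underlying)"
    obtain p q where pq: "(p, q) \<in> D" "p \<in> v ` carrier G" "q \<in> v ` carrier G"
      using imageI[of \<one> "carrier G" arc] by (auto simp: D_def arc_def)
    then have "(p, q) \<in> parcs underlying" "(q, p) \<in> parcs underlying" by auto
    then obtain g where "g \<in> graph_automorphisms oriented" "g p = q" "g q = p"
      using tr unfolding transitive_via_def by fastforce
    then have "(q, p) \<in> D" using pq unfolding graph_automorphisms_def by fastforce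
    then show False using pq D_asym by blast
  qed
qed

lemma card_carrier_le: "card (carrier G) \<le> (card (pverts underlying))\<^sup>2"
proof -
  have "card (carrier G) = card (arc ` carrier G)" by (simp add: card_image inj_arc)
  also have "\<dots> \<le> card (v ` carrier G \<times> v ` carrier G)"
    using finite_carrier by (intro card_mono) (auto simp: arc_def)
  finally show ?thesis by (simp add: card_cartesian_product power2_eq_square)
qed

end

section \<open>Permutations twisted by involutions\<close>

text \<open>One graph is chosen for each order that occurs; there are infinitely many orders, and
  isomorphic graphs have the same order.\<close>

lemma infinitely_many_graphsI:
  assumes "\<And>n. \<exists>\<Gamma>. P \<Gamma> \<and> n \<le> card (pverts \<Gamma>)"
  shows "infinitely_many_graphs P"
proof -
  define N where "N = {card (pverts \<Gamma>) | \<Gamma>. P \<Gamma>}"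
  have "\<forall>k\<in>N. \<exists>\<Gamma>. P \<Gamma> \<and> card (pverts \<Gamma>) = k" by (auto simp: N_def)
  then obtain g where g: "\<And>k. k \<in> N \<Longrightarrow> P (g k) \<and> card (pverts (g k)) = k" by metis
  have "infinite N"
    unfolding infinite_nat_iff_unbounded_le using assms by (fastforce simp: N_def)
  moreover have "inj_on g N" using g by (metis inj_onI)
  ultimately have "infinite (g ` N)" by (simp add: finite_image_iff)
  moreover have "\<not> digraph_iso (with_proj (g k)) (with_proj (g l))" if "k \<in> N" "l \<in> N" "g k \<noteq> g l" for k l
  proof
    assume "digraph_iso (with_proj (g k)) (with_proj (g l))"
    then obtain hom where hom: "pre_digraph.digraph_isomorphism (with_proj (g k)) hom"
      and eq: "with_proj (g l) = app_iso hom (with_proj (g k))"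
      unfolding digraph_iso_def by blast
    have "pverts (g l) = iso_verts hom ` pverts (g k)"
      using arg_cong[OF eq, of verts] by simp
    moreover have "inj_on (iso_verts hom) (pverts (g k))"
      using pre_digraph.digraph_isomorphism_inj_on_verts[OF hom] by simp
    ultimately have "card (pverts (g l)) = card (pverts (g k))" by (simp add: card_image)
    then show False using g that by metis
  qed
  ultimately show ?thesis
    unfolding infinitely_many_graphs_def using g
    by (intro exI[of _ "g ` N"]) (auto simp: pairwise_def)
qed

lemma (in group) coset_labelling:
  assumes "finite (carrier G)" "h \<in> carrier G" "h \<otimes> h = \<one>"
  obtains v :: "'a \<Rightarrow> nat" where
    "\<And>x y. \<lbrakk>x \<in> carrier G; y \<in> carrier G\<rbrakk> \<Longrightarrow> v x = v y \<longleftrightarrow> y = x \<or> y = x \<otimes> h"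
proof -
  let ?C = "\<lambda>x. {x, x \<otimes> h}"
  obtain i :: "'a set \<Rightarrow> nat" where i: "inj_on i (?C ` carrier G)"
    using finite_imp_inj_to_nat_seg[of "?C ` carrier G"] assms(1) by blast
  have hh: "x \<otimes> h \<otimes> h = x" if "x \<in> carrier G" for x
    using that assms by (simp add: m_assoc)
  show thesis
  proof
    fix x y assume "x \<in> carrier G" "y \<in> carrier G"
    then have "i (?C x) = i (?C y) \<longleftrightarrow> ?C x = ?C y"
      using i by (auto dest: inj_onD)
    also have "\<dots> \<longleftrightarrow> y = x \<or> y = x \<otimes> h"
      using hh[OF \<open>x \<in> carrier G\<close>] by (auto simp: doubleton_eq_iff)
    finally show "i (?C x) = i (?C y) \<longleftrightarrow> y = x \<or> y = x \<otimes> h" .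
  qed
qed

lemma less_5_cases: "j = 0 \<or> j = 1 \<or> j = 2 \<or> j = 3 \<or> j = 4" if "j < 5" for j :: nat
  using that by linarith

lemma ex_less_5I: "\<lbrakk>j < 5; x < m; P j x\<rbrakk> \<Longrightarrow> \<exists>j<5. \<exists>x<m. P j x" for j x m :: nat
  by blast

text \<open>The Boolean \<open>e\<close> encodes the step: \<open>a h\<close> if true,
  \<open>a\<close> if false. This is the effect of the optional factor \<open>h\<close> on
  coordinate \<open>j\<close>.\<close>

definition twist :: "(nat \<Rightarrow> nat \<Rightarrow> nat) \<Rightarrow> bool \<Rightarrow> nat \<Rightarrow> nat \<Rightarrow> nat" where
  "twist f e j x = (if e then f j x else x)"

text \<open>
  Here \<open>f j\<close> is the action of \<open>h\<close> on coordinate \<open>j\<close>, and \<open>full\<close> says whether \<open>(ah)\<^sup>5 = 1\<close>. The remaining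
  assumptions spell out the conditions on words in \<open>a\<close> and \<open>h\<close>, the shift \<open>a\<close> lowering \<open>j\<close> by \<open>1\<close>.
\<close>

locale twisted_rotation =
  fixes m :: nat and f :: "nat \<Rightarrow> nat \<Rightarrow> nat" and full :: bool
  assumes m_pos: "0 < m"
    and f_less: "\<lbrakk>j < 5; x < m\<rbrakk> \<Longrightarrow> f j x < m"
    and f_f: "\<lbrakk>j < 5; x < m\<rbrakk> \<Longrightarrow> f j (f j x) = x"
    and f_translates: "\<exists>j<5. \<forall>x. Suc x < m \<longrightarrow> f j (f (Suc j mod 5) x) = Suc x"
    and f_not_commute: "\<exists>j<5. \<exists>x<m. f j (f (Suc j mod 5) x) \<noteq> f (Suc j mod 5) (f j x)"
    and f_not_parallel:
      "\<exists>j<5. \<exists>x<m. f ((j + 3) mod 5) (twist f s ((j + 4) mod 5) x) \<noteq> twist f t ((j + 4) mod 5) (f j x)"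
    and f_full: "\<lbrakk>full; j < 5; x < m\<rbrakk> \<Longrightarrow>
      f ((j + 1) mod 5) (f ((j + 2) mod 5) (f ((j + 3) mod 5) (f ((j + 4) mod 5) (f j x)))) = x"
    and f_words: "(\<And>j x. \<lbrakk>j < 5; x < m\<rbrakk> \<Longrightarrow>
      twist f e0 ((j + 1) mod 5) (twist f e1 ((j + 2) mod 5) (twist f e2 ((j + 3) mod 5)
        (twist f e3 ((j + 4) mod 5) (twist f e4 j x)))) = x)
      \<Longrightarrow> (e0 \<longrightarrow> full) \<and> e1 = e0 \<and> e2 = e0 \<and> e3 = e0 \<and> e4 = e0"
begin

section \<open>The permutation group generated by \<open>rot\<close> and \<open>flip\<close>\<close>

definition pts :: "(nat \<times> nat) set" where
  "pts = {..<5} \<times> {..<m}"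

text \<open>Adding 4 lowers the coordinate by one modulo 5 without leaving the natural
  numbers.\<close>

definition rot :: "nat \<times> nat \<Rightarrow> nat \<times> nat" where
  "rot = (\<lambda>s\<in>pts. ((fst s + 4) mod 5, snd s))"

definition flip :: "nat \<times> nat \<Rightarrow> nat \<times> nat" where
  "flip = (\<lambda>s\<in>pts. (fst s, f (fst s) (snd s)))"

definition grp :: "(nat \<times> nat \<Rightarrow> nat \<times> nat) monoid" where
  "grp = (BijGroup pts)\<lparr>carrier := generate (BijGroup pts) {rot, flip}\<rparr>"

lemma pts_iff [simp]: "(j, x) \<in> pts \<longleftrightarrow> j < 5 \<and> x < m"
  by (simp add: pts_def)

lemma rot_apply [simp]: "\<lbrakk>j < 5; x < m\<rbrakk> \<Longrightarrow> rot (j, x) = ((j + 4) mod 5, x)"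
  by (simp add: rot_def)

lemma flip_apply [simp]: "\<lbrakk>j < 5; x < m\<rbrakk> \<Longrightarrow> flip (j, x) = (j, f j x)"
  by (simp add: flip_def)

lemma rot_Bij: "rot \<in> Bij pts"
proof -
  have "bij_betw rot pts pts"
    by (rule bij_betw_byWitness[where f' = "\<lambda>s. (Suc (fst s) mod 5, snd s)"])
      (auto simp: pts_def rot_def mod_simps)
  then show ?thesis by (simp add: Bij_def rot_def)
qed

lemma flip_Bij: "flip \<in> Bij pts"
proof -
  have "bij_betw flip pts pts"
    by (rule bij_betw_byWitness[where f' = flip]) (auto simp: f_f f_less)
  then show ?thesis by (simp add: Bij_def flip_def)
qed

sublocale P: group "BijGroup pts"
  by (rule group_BijGroup)

lemma gens_in: "{rot, flip} \<subseteq> carrier (BijGroup pts)"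
  using rot_Bij flip_Bij by (simp add: BijGroup_def)

lemma subgroup_grp: "subgroup (carrier grp) (BijGroup pts)"
  using P.generate_is_subgroup[OF gens_in] by (simp add: grp_def)

sublocale G: group grp
  using P.subgroup_imp_group[OF subgroup_grp] by (simp add: grp_def)

lemma carrier_grp_Bij: "x \<in> carrier grp \<Longrightarrow> x \<in> Bij pts"
  using subgroup.subset[OF subgroup_grp] by (auto simp: BijGroup_def)

lemma apply_pts: "\<lbrakk>x \<in> carrier grp; s \<in> pts\<rbrakk> \<Longrightarrow> x s \<in> pts"
  by (metis Bij_imp_funcset carrier_grp_Bij funcset_mem)

lemma mult_apply:
  assumes "x \<in> carrier grp" "y \<in> carrier grp" "s \<in> pts"
  shows "(x \<otimes>\<^bsub>grp\<^esub> y) s = x (y s)"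
proof -
  have "x \<otimes>\<^bsub>grp\<^esub> y = x \<otimes>\<^bsub>BijGroup pts\<^esub> y" by (simp add: grp_def)
  then show ?thesis
    using carrier_grp_Bij[OF assms(1)] carrier_grp_Bij[OF assms(2)] assms(3)
    by (simp add: BijGroup_def compose_eq)
qed

lemma one_apply: "s \<in> pts \<Longrightarrow> \<one>\<^bsub>grp\<^esub> s = s"
  by (simp add: grp_def BijGroup_def)

lemma rot_closed [simp]: "rot \<in> carrier grp" and flip_closed [simp]: "flip \<in> carrier grp"
  by (auto simp: grp_def intro: generate.incl)

lemma grp_eqI:
  assumes "x \<in> carrier grp" "y \<in> carrier grp" "\<And>s. s \<in> pts \<Longrightarrow> x s = y s"
  shows "x = y"
  using assms Bij_imp_extensional[OF carrier_grp_Bij] by (meson extensionalityI)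

lemma flip_flip: "flip \<otimes>\<^bsub>grp\<^esub> flip = \<one>\<^bsub>grp\<^esub>"
  by (rule grp_eqI) (auto simp: mult_apply one_apply f_f f_less)

lemma inv_rot_apply:
  assumes "j < 5" "x < m"
  shows "(inv\<^bsub>grp\<^esub> rot) (j, x) = (Suc j mod 5, x)"
proof -
  have "rot (Suc j mod 5, x) = (j, x)" using assms by (simp add: mod_simps)
  then show ?thesis
    using assms mult_apply[of "inv\<^bsub>grp\<^esub> rot" rot "(Suc j mod 5, x)"] one_apply by simp
qed

lemma finite_grp: "finite (carrier grp)"
proof -
  have "carrier grp \<subseteq> (\<Pi>\<^sub>E s\<in>pts. pts)"
  proof
    fix x assume "x \<in> carrier grp"
    then have "x \<in> Bij pts" by (rule carrier_grp_Bij)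
    then show "x \<in> (\<Pi>\<^sub>E s\<in>pts. pts)" unfolding PiE_def
      using Bij_imp_funcset Bij_imp_extensional by (intro IntI)
  qed
  then show ?thesis by (rule finite_subset) (simp add: finite_PiE pts_def)
qed

lemma generate_grp: "generate grp {rot, flip} = carrier grp"
proof -
  have "{rot, flip} \<subseteq> carrier grp" by simp
  then show ?thesis
    using P.generate_consistent[OF _ subgroup_grp, of "{rot, flip}"] by (simp add: grp_def)
qed

text \<open>
  With the inverse, multiplying \<open>x\<close> on the right acts last, so no invariant of \<open>x\<close> is needed to see
  how the level changes.
\<close>

definition lev :: "(nat \<times> nat \<Rightarrow> nat \<times> nat) \<Rightarrow> nat" where
  "lev x = fst ((inv\<^bsub>grp\<^esub> x) (0, 0))"

lemma lev_mult:
  assumes "x \<in> carrier grp" "y \<in> carrier grp"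
  shows "lev (x \<otimes>\<^bsub>grp\<^esub> y) = fst ((inv\<^bsub>grp\<^esub> y) ((inv\<^bsub>grp\<^esub> x) (0, 0)))"
  using assms m_pos by (simp add: lev_def G.inv_mult_group mult_apply)

lemma inv_at_origin:
  assumes "x \<in> carrier grp"
  obtains j y where "(inv\<^bsub>grp\<^esub> x) (0, 0) = (j, y)" "j < 5" "y < m"
  using apply_pts[of "inv\<^bsub>grp\<^esub> x" "(0, 0)"] assms m_pos
  by (cases "(inv\<^bsub>grp\<^esub> x) (0, 0)") auto

lemma lev_rot:
  assumes "x \<in> carrier grp"
  shows "lev (x \<otimes>\<^bsub>grp\<^esub> rot) = Suc (lev x) mod 5"
proof (rule inv_at_origin[OF assms])
  fix j y assume "(inv\<^bsub>grp\<^esub> x) (0, 0) = (j, y)" "j < 5" "y < m"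
  then show ?thesis using lev_mult[OF assms rot_closed] by (simp add: inv_rot_apply lev_def[of x])
qed

lemma inv_flip: "inv\<^bsub>grp\<^esub> flip = flip"
  by (rule G.inv_equality) (simp_all add: flip_flip)

lemma lev_flip:
  assumes "x \<in> carrier grp"
  shows "lev (x \<otimes>\<^bsub>grp\<^esub> flip) = lev x"
proof (rule inv_at_origin[OF assms])
  fix j y assume "(inv\<^bsub>grp\<^esub> x) (0, 0) = (j, y)" "j < 5" "y < m"
  then show ?thesis using lev_mult[OF assms flip_closed] by (simp add: inv_flip lev_def[of x])
qed

section \<open>Words, size of the group and the resulting graph\<close>

definition step :: "bool \<Rightarrow> nat \<times> nat \<Rightarrow> nat \<times> nat" where
  "step e = (if e then rot \<otimes>\<^bsub>grp\<^esub> flip else rot)"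

lemma step_closed [simp]: "step e \<in> carrier grp"
  by (simp add: step_def)

lemma twist_less: "\<lbrakk>j < 5; x < m\<rbrakk> \<Longrightarrow> twist f e j x < m"
  by (simp add: twist_def f_less)

lemma step_apply [simp]: "\<lbrakk>j < 5; x < m\<rbrakk> \<Longrightarrow> step e (j, x) = ((j + 4) mod 5, twist f e j x)"
  by (simp add: step_def twist_def mult_apply f_less)

lemma steps_iff: "s \<in> {rot, rot \<otimes>\<^bsub>grp\<^esub> flip} \<longleftrightarrow> (\<exists>e. s = step e)"
  by (auto simp: step_def)

text \<open>The rightmost step acts first, in coordinate \<open>j\<close>; each step lowers the
  coordinate by one, so five of them return to \<open>j\<close>.\<close>

lemma word_apply:
  assumes "j < 5" "x < m"
  shows "(step e0 \<otimes>\<^bsub>grp\<^esub> step e1 \<otimes>\<^bsub>grp\<^esub> step e2 \<otimes>\<^bsub>grp\<^esub> step e3 \<otimes>\<^bsub>grp\<^esub> step e4) (j, x) =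
    (j, twist f e0 ((j + 1) mod 5) (twist f e1 ((j + 2) mod 5) (twist f e2 ((j + 3) mod 5)
        (twist f e3 ((j + 4) mod 5) (twist f e4 j x)))))"
  using less_5_cases[OF assms(1)] assms(2) by (elim disjE) (simp_all add: mult_apply twist_less numeral_2_eq_2[symmetric])

text \<open>The fifth power of \<open>rot\<close> is always trivial; that of \<open>rot\<close>
  times \<open>flip\<close> is trivial when \<open>full\<close> holds.\<close>

definition B :: "(nat \<times> nat \<Rightarrow> nat \<times> nat) set" where
  "B = step ` {e. e \<longrightarrow> full}"

lemma flip_neq_one: "flip \<noteq> \<one>\<^bsub>grp\<^esub>"
proof
  assume one: "flip = \<one>\<^bsub>grp\<^esub>"
  have fixed: "f j x = x" if "j < 5" "x < m" for j x
    using that flip_apply[OF that] one_apply[of "(j, x)"] by (simp add: one)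
  obtain j x where "j < 5" "x < m" "f j (f (Suc j mod 5) x) \<noteq> f (Suc j mod 5) (f j x)"
    using f_not_commute by blast
  then show False using fixed[of j x] fixed[of "Suc j mod 5" x] by simp
qed

lemma card_B: "card B = (if full then 2 else 1)"
proof -
  have "{e. e \<longrightarrow> full} = (if full then {False, True} else {False})" by auto
  then show ?thesis using flip_neq_one by (simp add: B_def step_def)
qed

text \<open>Conjugation by \<open>rot\<close> brings the action on the next coordinate to coordinate
  \<open>j\<close>, where it can be compared or composed with \<open>f j\<close>.\<close>

lemma flip_conj_apply:
  assumes "j < 5" "x < m"
  shows "(rot \<otimes>\<^bsub>grp\<^esub> flip \<otimes>\<^bsub>grp\<^esub> inv\<^bsub>grp\<^esub> rot) (j, x) = (j, f (Suc j mod 5) x)"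
  using assms by (simp add: mult_apply inv_rot_apply f_less mod_simps)

text \<open>The product of \<open>flip\<close> and its conjugate moves \<open>(j, x)\<close> to
  \<open>(j, Suc x)\<close>, so the orbit of \<open>(j, 0)\<close> contains \<open>m\<close> points
  of coordinate \<open>j\<close>.\<close>

lemma card_grp: "m \<le> card (carrier grp)"
proof -
  obtain j where j: "j < 5" and tr: "\<And>x. Suc x < m \<Longrightarrow> f j (f (Suc j mod 5) x) = Suc x"
    using f_translates by blast
  let ?c = "rot \<otimes>\<^bsub>grp\<^esub> flip \<otimes>\<^bsub>grp\<^esub> inv\<^bsub>grp\<^esub> rot"
  define g where "g = flip \<otimes>\<^bsub>grp\<^esub> ?c"
  have g: "g \<in> carrier grp" by (simp add: g_def)
  have gs: "g (j, x) = (j, Suc x)" if "Suc x < m" for x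
    using that j by (simp add: g_def mult_apply[of flip ?c] flip_conj_apply f_less tr)
  have "\<exists>y\<in>carrier grp. y (j, 0) = (j, k)" if "k < m" for k
    using that
  proof (induction k)
    case 0
    then show ?case using one_apply[of "(j, 0)"] j by (intro bexI[of _ "\<one>\<^bsub>grp\<^esub>"]) auto
  next
    case (Suc k)
    then obtain y where "y \<in> carrier grp" "y (j, 0) = (j, k)" by auto
    then show ?case using Suc.prems g gs j
      by (intro bexI[of _ "g \<otimes>\<^bsub>grp\<^esub> y"]) (auto simp: mult_apply)
  qed
  then have "{..<m} \<subseteq> (\<lambda>y. snd (y (j, 0))) ` carrier grp"
    by (force simp: image_iff)
  then have "card {..<m} \<le> card (carrier grp)"
    by (rule surj_card_le[OF finite_grp])
  then show ?thesis by simp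
qed

lemma coset_graph_grp:
  assumes "\<And>x y. \<lbrakk>x \<in> carrier grp; y \<in> carrier grp\<rbrakk> \<Longrightarrow> v x = v y \<longleftrightarrow> y = x \<or> y = x \<otimes>\<^bsub>grp\<^esub> flip"
  shows "coset_graph grp rot flip v lev B"
proof
  show "finite (carrier grp)" by (rule finite_grp)
  show "rot \<in> carrier grp" "flip \<in> carrier grp" by auto
  show "flip \<otimes>\<^bsub>grp\<^esub> flip = \<one>\<^bsub>grp\<^esub>" by (rule flip_flip)
  show "generate grp {rot, flip} = carrier grp" by (rule generate_grp)
  show "lev (x \<otimes>\<^bsub>grp\<^esub> rot) = Suc (lev x) mod 5" "lev (x \<otimes>\<^bsub>grp\<^esub> flip) = lev x"
    if "x \<in> carrier grp" for x
    using that by (rule lev_rot, rule lev_flip)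
  show "v x = v y \<longleftrightarrow> y = x \<or> y = x \<otimes>\<^bsub>grp\<^esub> flip" if "x \<in> carrier grp" "y \<in> carrier grp" for x y
    using that by (rule assms)
  show "B \<subseteq> {rot, rot \<otimes>\<^bsub>grp\<^esub> flip}" "B \<noteq> {}" by (auto simp: B_def step_def)
  show "flip \<otimes>\<^bsub>grp\<^esub> (rot \<otimes>\<^bsub>grp\<^esub> flip \<otimes>\<^bsub>grp\<^esub> inv\<^bsub>grp\<^esub> rot) \<noteq>
      (rot \<otimes>\<^bsub>grp\<^esub> flip \<otimes>\<^bsub>grp\<^esub> inv\<^bsub>grp\<^esub> rot) \<otimes>\<^bsub>grp\<^esub> flip" (is "flip \<otimes>\<^bsub>grp\<^esub> ?c \<noteq> _")
  proof
    assume eq: "flip \<otimes>\<^bsub>grp\<^esub> ?c = ?c \<otimes>\<^bsub>grp\<^esub> flip"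
    obtain j x where jx: "j < 5" "x < m" and neq: "f j (f (Suc j mod 5) x) \<noteq> f (Suc j mod 5) (f j x)"
      using f_not_commute by blast
    have "f j (f (Suc j mod 5) x) = f (Suc j mod 5) (f j x)"
      using fun_cong[OF eq, of "(j, x)"] jx
      by (simp add: mult_apply[of flip ?c] mult_apply[of ?c flip] flip_conj_apply f_less)
    then show False using neq by contradiction
  qed
  show "flip \<otimes>\<^bsub>grp\<^esub> s \<otimes>\<^bsub>grp\<^esub> rot \<noteq> t \<otimes>\<^bsub>grp\<^esub> rot \<otimes>\<^bsub>grp\<^esub> flip"
    if st: "s \<in> {rot, rot \<otimes>\<^bsub>grp\<^esub> flip}" "t \<in> {rot, rot \<otimes>\<^bsub>grp\<^esub> flip}" for s t
  proof
    obtain d e where [simp]: "s = step d" "t = step e" using st unfolding steps_iff by blast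
    assume eq: "flip \<otimes>\<^bsub>grp\<^esub> s \<otimes>\<^bsub>grp\<^esub> rot = t \<otimes>\<^bsub>grp\<^esub> rot \<otimes>\<^bsub>grp\<^esub> flip"
    obtain j x where jx: "j < 5" "x < m"
      and neq: "f ((j + 3) mod 5) (twist f d ((j + 4) mod 5) x) \<noteq> twist f e ((j + 4) mod 5) (f j x)"
      using f_not_parallel[of d e] by blast
    \<comment> \<open>Both sides of \<open>eq\<close> send \<open>(j, x)\<close> to coordinate
      \<open>j + 3\<close> modulo 5; the second components are compared.\<close>
    have "f ((j + 3) mod 5) (twist f d ((j + 4) mod 5) x) = twist f e ((j + 4) mod 5) (f j x)"
      using less_5_cases[OF jx(1)] fun_cong[OF eq, of "(j, x)"] jx(2)
      by (elim disjE) (simp_all add: mult_apply twist_less f_less numeral_2_eq_2[symmetric])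
    then show False using neq by contradiction
  qed
  show "b \<otimes>\<^bsub>grp\<^esub> b \<otimes>\<^bsub>grp\<^esub> b \<otimes>\<^bsub>grp\<^esub> b \<otimes>\<^bsub>grp\<^esub> b = \<one>\<^bsub>grp\<^esub>" if bB: "b \<in> B" for b
  proof -
    obtain e where b: "b = step e" and e: "e \<longrightarrow> full"
      using bB unfolding B_def by blast
    show ?thesis unfolding b
    proof (rule grp_eqI)
      fix s assume "s \<in> pts"
      then obtain j x where s: "s = (j, x)" "j < 5" "x < m" by (cases s) auto
      then show "(step e \<otimes>\<^bsub>grp\<^esub> step e \<otimes>\<^bsub>grp\<^esub> step e \<otimes>\<^bsub>grp\<^esub> step e \<otimes>\<^bsub>grp\<^esub> step e) s = \<one>\<^bsub>grp\<^esub> s"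
        using e f_full[of j x] unfolding s(1) word_apply[OF s(2,3)] by (simp add: one_apply twist_def)
    qed auto
  qed
  show "s0 \<in> B \<and> s1 = s0 \<and> s2 = s0 \<and> s3 = s0 \<and> s4 = s0"
    if s: "s0 \<in> {rot, rot \<otimes>\<^bsub>grp\<^esub> flip}" "s1 \<in> {rot, rot \<otimes>\<^bsub>grp\<^esub> flip}" "s2 \<in> {rot, rot \<otimes>\<^bsub>grp\<^esub> flip}"
      "s3 \<in> {rot, rot \<otimes>\<^bsub>grp\<^esub> flip}" "s4 \<in> {rot, rot \<otimes>\<^bsub>grp\<^esub> flip}"
      and w: "s0 \<otimes>\<^bsub>grp\<^esub> s1 \<otimes>\<^bsub>grp\<^esub> s2 \<otimes>\<^bsub>grp\<^esub> s3 \<otimes>\<^bsub>grp\<^esub> s4 = \<one>\<^bsub>grp\<^esub>"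
    for s0 s1 s2 s3 s4
  proof -
    obtain e0 e1 e2 e3 e4 where e: "s0 = step e0" "s1 = step e1" "s2 = step e2" "s3 = step e3" "s4 = step e4"
      using s unfolding steps_iff by blast
    have "(e0 \<longrightarrow> full) \<and> e1 = e0 \<and> e2 = e0 \<and> e3 = e0 \<and> e4 = e0"
    proof (rule f_words)
      fix j x :: nat assume jx: "j < 5" "x < m"
      show "twist f e0 ((j + 1) mod 5) (twist f e1 ((j + 2) mod 5) (twist f e2 ((j + 3) mod 5)
        (twist f e3 ((j + 4) mod 5) (twist f e4 j x)))) = x"
        using word_apply[OF jx, of e0 e1 e2 e3 e4] w one_apply[of "(j, x)"] jx by (simp add: e)
    qed
    then show ?thesis unfolding e by (simp add: B_def)
  qed
qed

lemma ex_graph: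
  "\<exists>\<Gamma> :: nat pair_pre_digraph. finite_simple_connected \<Gamma> \<and> regular_of_valency 4 \<Gamma> \<and> girth \<Gamma> = 5 \<and>
    (\<exists>G. half_arc_transitive G \<Gamma>) \<and> each_edge_on_cycles (if full then 2 else 1) 5 \<Gamma> \<and>
    m \<le> (card (pverts \<Gamma>))\<^sup>2"
proof -
  obtain v :: "(nat \<times> nat \<Rightarrow> nat \<times> nat) \<Rightarrow> nat" where
    "\<And>x y. \<lbrakk>x \<in> carrier grp; y \<in> carrier grp\<rbrakk> \<Longrightarrow> v x = v y \<longleftrightarrow> y = x \<or> y = x \<otimes>\<^bsub>grp\<^esub> flip"
    using G.coset_labelling[OF finite_grp flip_closed flip_flip] by blast
  then interpret C: coset_graph grp rot flip v lev B by (rule coset_graph_grp)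
  show ?thesis
    using C.pair_graph_underlying C.connected_underlying C.regular_underlying C.girth_underlying
      C.half_arc_transitive_underlying C.each_edge_on_cycles_underlying C.card_carrier_le card_grp
    unfolding finite_simple_connected_def card_B
    by (intro exI[of _ C.underlying]) (auto intro: order_trans)
qed

end

section \<open>The two families\<close>

text \<open>Modulo \<open>m\<close> this is the reflection \<open>p\<close>, sending
  \<open>x\<close> to \<open>-1 - x\<close>.\<close>

definition reflect :: "nat \<Rightarrow> nat \<Rightarrow> nat" where
  "reflect m x = m - 1 - x"

text \<open>Modulo \<open>m\<close> this is the reflection \<open>q\<close>, sending
  \<open>x\<close> to \<open>-x\<close>; applied after \<open>p\<close> it gives the translation by
  one.\<close>

definition reflect0 :: "nat \<Rightarrow> nat \<Rightarrow> nat" where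
  "reflect0 m x = (if x = 0 then 0 else m - x)"

lemma twisted_rotation_one:
  fixes m :: nat
  assumes m: "3 \<le> m"
  defines "f \<equiv> \<lambda>j. if j = 0 then reflect0 m else reflect m"
  shows "twisted_rotation m f False"
proof
  have vals: "f 0 = reflect0 m" "f 1 = reflect m" "f (Suc 0) = reflect m" "f 2 = reflect m"
    "f 3 = reflect m" "f 4 = reflect m"
    by (simp_all add: f_def)
  note ev = vals reflect_def reflect0_def twist_def
  show "0 < m" using m by simp
  show "f j x < m" "f j (f j x) = x" if "x < m" for j x
    using that by (auto simp: f_def reflect_def reflect0_def)
  show "\<exists>j<5. \<forall>x. Suc x < m \<longrightarrow> f j (f (Suc j mod 5) x) = Suc x"
    by (intro exI[of _ 0]) (auto simp: ev)
  show "\<exists>j<5. \<exists>x<m. f j (f (Suc j mod 5) x) \<noteq> f (Suc j mod 5) (f j x)"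
    using m by (intro ex_less_5I[of 0 0]) (auto simp: ev)
  show "\<exists>j<5. \<exists>x<m. f ((j + 3) mod 5) (twist f s ((j + 4) mod 5) x) \<noteq>
    twist f t ((j + 4) mod 5) (f j x)" for s t
  \<comment> \<open>For \<open>s = t\<close>, coordinate 0 has \<open>q\<close> on one side in place
    of a \<open>p\<close> on the other. For \<open>s \<noteq> t\<close>, coordinate 3 has only
    factors \<open>p\<close>, and their numbers differ by one.\<close>
  proof (cases "s = t")
    case True
    then show ?thesis using m
      by (intro ex_less_5I[of 0 0]; cases t) (auto simp: ev)
  next
    case False
    then show ?thesis using m
      by (intro ex_less_5I[of 3 0]; cases t) (auto simp: ev)
  qed
  fix e0 e1 e2 e3 e4
  assume w: "\<And>j x. \<lbrakk>j < 5; x < m\<rbrakk> \<Longrightarrow>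
    twist f e0 ((j + 1) mod 5) (twist f e1 ((j + 2) mod 5) (twist f e2 ((j + 3) mod 5)
        (twist f e3 ((j + 4) mod 5) (twist f e4 j x)))) = x"
  \<comment> \<open>Each coordinate has as many reflections as the word has factors
    \<open>a h\<close>. An odd number gives a reflection, and none fixes both 0 and 1 as
    \<open>m \<ge> 3\<close>. For an even positive number, a coordinate where \<open>q\<close> meets
    a factor \<open>a h\<close> undergoes a translation by 1 or -1.\<close>
  show "(e0 \<longrightarrow> False) \<and> e1 = e0 \<and> e2 = e0 \<and> e3 = e0 \<and> e4 = e0"
    using w[of 0 0] w[of 0 1] w[of 1 0] w[of 2 0] w[of 3 0] w[of 4 0] m
    by (cases e0; cases e1; cases e2; cases e3; cases e4) (simp_all add: ev split: if_splits)
qed simp_all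

lemma twisted_rotation_two:
  fixes m :: nat
  assumes m: "3 \<le> m"
  defines "f \<equiv> \<lambda>j. if j = 0 then id else if j = 1 \<or> j = 4 then reflect m else reflect0 m"
  shows "twisted_rotation m f True"
proof
  have vals: "f 0 = id" "f 1 = reflect m" "f (Suc 0) = reflect m" "f 2 = reflect0 m"
    "f 3 = reflect0 m" "f 4 = reflect m"
    by (simp_all add: f_def)
  note ev = vals reflect_def reflect0_def twist_def
  show "0 < m" using m by simp
  show "f j x < m" "f j (f j x) = x" if "x < m" for j x
    using that by (auto simp: f_def reflect_def reflect0_def)
  show "\<exists>j<5. \<forall>x. Suc x < m \<longrightarrow> f j (f (Suc j mod 5) x) = Suc x"
    by (intro exI[of _ 3]) (auto simp: ev)
  show "\<exists>j<5. \<exists>x<m. f j (f (Suc j mod 5) x) \<noteq> f (Suc j mod 5) (f j x)"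
    using m by (intro ex_less_5I[of 3 0]) (auto simp: ev)
  show "\<exists>j<5. \<exists>x<m. f ((j + 3) mod 5) (twist f s ((j + 4) mod 5) x) \<noteq>
    twist f t ((j + 4) mod 5) (f j x)" for s t
  \<comment> \<open>The parities of the numbers of reflections differ: in coordinate 0 for
    \<open>s = t\<close>, because \<open>f 0\<close> is the identity, and in coordinate 3 otherwise.
    Since \<open>q\<close> fixes 0, the point 1 is used when \<open>q\<close> stands alone.\<close>
  proof (cases "s = t")
    case True
    then show ?thesis using m
      by (intro ex_less_5I[of 0 "if s then 0 else 1"]; cases t) (auto simp: ev)
  next
    case False
    then show ?thesis using m
      by (intro ex_less_5I[of 3 0]; cases t) (auto simp: ev)
  qed
  have refl: "reflect m x < m" "reflect m (reflect m x) = x" "reflect0 m x < m" "reflect0 m (reflect0 m x) = x"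
    if "x < m" for x
    using that by (auto simp: reflect_def reflect0_def)
  \<comment> \<open>Every cyclic rotation of the word \<open>p q q p\<close> cancels.\<close>
  show "f ((j + 1) mod 5) (f ((j + 2) mod 5) (f ((j + 3) mod 5) (f ((j + 4) mod 5) (f j x)))) = x"
    if "j < 5" "x < m" for j x :: nat
    using less_5_cases[OF that(1)] that(2)
    by (elim disjE) (simp_all add: vals refl numeral_2_eq_2[symmetric])
  fix e0 e1 e2 e3 e4
  assume w: "\<And>j x. \<lbrakk>j < 5; x < m\<rbrakk> \<Longrightarrow>
    twist f e0 ((j + 1) mod 5) (twist f e1 ((j + 2) mod 5) (twist f e2 ((j + 3) mod 5)
        (twist f e3 ((j + 4) mod 5) (twist f e4 j x)))) = x"
  \<comment> \<open>In a mixed word the identity coordinate meets a factor \<open>a h\<close> for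
    some \<open>j\<close> and a factor \<open>a\<close> for another. The numbers of reflections then
    differ by one, so one of them is odd, and the points 0 and 1 detect the reflection.\<close>
  show "(e0 \<longrightarrow> True) \<and> e1 = e0 \<and> e2 = e0 \<and> e3 = e0 \<and> e4 = e0"
    using w[of 0 0] w[of 0 1] w[of 1 0] w[of 1 1] w[of 2 0] w[of 2 1] w[of 3 0] w[of 3 1] w[of 4 0] w[of 4 1] m
    by (cases e0; cases e1; cases e2; cases e3; cases e4) (simp_all add: ev split: if_splits)
qed

lemma infinitely_many_graphs_twisted_rotation:
  assumes "\<And>m. 3 \<le> m \<Longrightarrow> twisted_rotation m (f m) full"
  shows "infinitely_many_graphs (\<lambda>\<Gamma>.
    finite_simple_connected \<Gamma> \<and> regular_of_valency 4 \<Gamma> \<and> girth \<Gamma> = 5 \<and>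
    (\<exists>G. half_arc_transitive G \<Gamma>) \<and> each_edge_on_cycles (if full then 2 else 1) 5 \<Gamma>)"
proof (rule infinitely_many_graphsI)
  fix n :: nat
  \<comment> \<open>The group has at least \<open>m\<close> elements and at most as many as the
    square of the order of the graph, so \<open>m \<ge> n\<^sup>2\<close> forces order at least
    \<open>n\<close>; the summand 3 ensures \<open>3 \<le> m\<close>.\<close>
  interpret twisted_rotation "n\<^sup>2 + 3" "f (n\<^sup>2 + 3)" full
    by (rule assms) simp
  obtain \<Gamma> :: "nat pair_pre_digraph" where \<Gamma>: "finite_simple_connected \<Gamma>" "regular_of_valency 4 \<Gamma>"
    "girth \<Gamma> = 5" "\<exists>G. half_arc_transitive G \<Gamma>" "each_edge_on_cycles (if full then 2 else 1) 5 \<Gamma>"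
    and card: "n\<^sup>2 + 3 \<le> (card (pverts \<Gamma>))\<^sup>2"
    using ex_graph by blast
  from card have "n\<^sup>2 \<le> (card (pverts \<Gamma>))\<^sup>2" by linarith
  then have "n \<le> card (pverts \<Gamma>)" by (rule power2_le_imp_le) simp
  then show "\<exists>\<Gamma> :: nat pair_pre_digraph. (finite_simple_connected \<Gamma> \<and> regular_of_valency 4 \<Gamma> \<and> girth \<Gamma> = 5 \<and>
      (\<exists>G. half_arc_transitive G \<Gamma>) \<and> each_edge_on_cycles (if full then 2 else 1) 5 \<Gamma>) \<and>
      n \<le> card (pverts \<Gamma>)"
    using \<Gamma> by blast
qed

theorem theorem6p7:
  shows "infinitely_many_graphs (\<lambda>\<Gamma>.
            finite_simple_connected \<Gamma> \<and> regular_of_valency 4 \<Gamma> \<and> girth \<Gamma> = 5 \<and>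
            (\<exists>G. half_arc_transitive G \<Gamma>) \<and> each_edge_on_cycles 1 5 \<Gamma>) \<and>
         infinitely_many_graphs (\<lambda>\<Gamma>.
            finite_simple_connected \<Gamma> \<and> regular_of_valency 4 \<Gamma> \<and> girth \<Gamma> = 5 \<and>
            (\<exists>G. half_arc_transitive G \<Gamma>) \<and> each_edge_on_cycles 2 5 \<Gamma>)"
  using infinitely_many_graphs_twisted_rotation[OF twisted_rotation_one]
    infinitely_many_graphs_twisted_rotation[OF twisted_rotation_two]
  by simp

end
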